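(* Let $G$ be a subcubic graph that satisfies one of the following: (a) $G$ is $0$-saturated and $g_3(G)\le 4$; (b) $G$ is $1$-saturated and $g_3(G)=3$. Then $G$ is $S$-packing colorable whenever one of the following holds: (i) $S=(1,1,3,k)$ for any integer $k\ge 3$; (ii) $S=(1,2,2,3)$; (iii) $S=(2,2,2,2,3)$ and $G\neq \mathcal{G}_1$; (iv) $S=(1,2,3,4,5,k)$ for any integer $k\ge 6$.
   Context: All graphs are finite, simple and undirected; $dist_G$ denotes the distance in $G$. For a non-decreasing sequence $S=(s_1,\dots,s_k)$ of positive integers, an $S$-packing coloring of $G$ is a partition of $V(G)$ into sets $V_1,\dots,V_k$ such that any two distinct vertices $u,v\in V_i$ satisfy $dist_G(u,v)>s_i$; $G$ is $S$-packing colorable if it admits one. A $k$-vertex is a vertex of degree $k$. $G$ is subcubic if its maximum degree is at most $3$. A subcubic graph is $k$-saturated ($0\le k\le 3$) if every $3$-vertex is adjacent to at most $k$ vertices of degree $3$. The local girth $g(v)$ of a vertex $v$ is the length of a shortest cycle containing $v$ ($\infty$ if none), and $g_3(G)=\max\{g(v): d_G(v)=3\}$. The graph $\mathcal{G}_1$ has vertices $v_1,\dots,v_6$ and edges $v_1v_2,v_2v_3,v_3v_4,v_4v_5,v_5v_1,v_5v_6,v_3v_6$ (a $5$-cycle $v_1v_2v_3v_4v_5$ plus a vertex $v_6$ adjacent to $v_3$ and $v_5$).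
   Formalization: In (iii), "G ≠ G_1" is replaced by "no connected component of G is isomorphic to G_1", since a disconnected graph such as G_1 plus an isolated vertex meets the stated hypotheses but is not (2,2,2,2,3)-packing colorable. *)

theory Defs
  imports
    "Graph_Theory.Graph_Theory"
    "HOL-Library.Extended_Nat"
    "HOL-Library.Disjoint_Sets"
begin

text \<open>
  A finite simple undirected graph is a \<^locale>\<open>pair_graph\<close>: a finite, loop-free, symmetric
  digraph without parallel arcs, each edge \<open>uv\<close> being the pair of arcs \<open>(u, v)\<close>, \<open>(v, u)\<close>. Hence
  the degree of a vertex is its out-degree.
\<close>

abbreviation vdegree :: "'a pair_pre_digraph \<Rightarrow> 'a \<Rightarrow> nat" where
  "vdegree G v \<equiv> out_degree (with_proj G) v"

definition subcubic :: "'a pair_pre_digraph \<Rightarrow> bool" where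
  "subcubic G \<longleftrightarrow> (\<forall>v \<in> pverts G. vdegree G v \<le> 3)"

definition saturated :: "nat \<Rightarrow> 'a pair_pre_digraph \<Rightarrow> bool" where
  "saturated k G \<longleftrightarrow> subcubic G \<and>
    (\<forall>v \<in> pverts G. vdegree G v = 3 \<longrightarrow>
       card {u \<in> pverts G. (v, u) \<in> parcs G \<and> vdegree G u = 3} \<le> k)"

text \<open>
  The value is \<open>\<infinity>\<close> for vertices in different components.
\<close>

definition gdist :: "'a pair_pre_digraph \<Rightarrow> 'a \<Rightarrow> 'a \<Rightarrow> ereal" where
  "gdist G u v = wf_digraph.\<mu> (with_proj G) (\<lambda>_. 1) u v"

text \<open>
  The library's \<^const>\<open>pre_digraph.cycle\<close> also admits the closed walk of length 2 running back and
  forth along one edge, which is not a cycle of the undirected graph; hence \<open>3 \<le> length p\<close>. The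
  vertices of a cycle are the tails of its arcs. \<open>Inf {} = \<infinity>\<close> for vertices on no cycle.
\<close>

definition local_girth :: "'a pair_pre_digraph \<Rightarrow> 'a \<Rightarrow> enat" where
  "local_girth G v =
     (INF p \<in> {p. pre_digraph.cycle (with_proj G) p \<and> 3 \<le> length p \<and> v \<in> fst ` set p}.
        enat (length p))"

text \<open>
  For a finite graph with a vertex of degree 3 the supremum is a maximum; without such a vertex
  it is 0.
\<close>

definition g3 :: "'a pair_pre_digraph \<Rightarrow> enat" where
  "g3 G = (SUP v \<in> {v \<in> pverts G. vdegree G v = 3}. local_girth G v)"

text \<open>
  Colour classes are indexed from 0 and may be empty.
\<close>

definition packing_colorable :: "nat list \<Rightarrow> 'a pair_pre_digraph \<Rightarrow> bool" where
  "packing_colorable S G \<longleftrightarrow>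
    (\<exists>V :: nat \<Rightarrow> 'a set.
       (\<Union>i < length S. V i) = pverts G \<and>
       disjoint_family_on V {..<length S} \<and>
       (\<forall>i < length S. \<forall>u \<in> V i. \<forall>v \<in> V i.
          u \<noteq> v \<longrightarrow> gdist G u v > ereal (real (S ! i))))"

definition graph_G1 :: "nat pair_pre_digraph" where
  "graph_G1 =
    \<lparr> pverts = {1..6},
      parcs = symcl {(1,2), (2,3), (3,4), (4,5), (5,1), (5,6), (3,6)} \<rparr>"

text \<open>
  For connected \<open>G\<close> this says that \<open>G\<close> is isomorphic to \<^const>\<open>graph_G1\<close>. On a symmetric digraph,
  the strongly connected components are the connected components of the undirected graph.
\<close>

definition has_G1_component :: "'a pair_pre_digraph \<Rightarrow> bool" where
  "has_G1_component G \<longleftrightarrow>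
    (\<exists>H \<in> pre_digraph.sccs (with_proj G). digraph_iso H (with_proj graph_G1))"

end

theory Submission
  imports Defs
begin

text \<open>
  Deleting a suitable set \<open>E\<close> of degree-2 vertices, one next to each 3-vertex and pairwise at
  distance at least 4, leaves a core of maximum degree 2. Every deleted vertex is dominated by a
  core vertex, so \<open>G\<close> retracts onto the core and the core is isometric in \<open>G\<close>; hence \<open>E\<close> can take a
  colour of value 3 and the core, a union of paths and cycles, is coloured periodically with the
  other colours, a path being treated as part of a longer cycle. Exceptions are two triangles joined
  by an edge, where no such \<open>E\<close> exists, and 5-cycles in the core, since 5 is not of the form
  \<open>3a + 4b\<close>; both are coloured by hand, and the 5-cycle with a doubled vertex is \<open>\<G>\<^sub>1\<close>.
\<close>

section \<open>Distance and packing colourings on a cycle\<close>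

definition cyclic_dist_le :: "nat \<Rightarrow> nat \<Rightarrow> nat \<Rightarrow> nat \<Rightarrow> bool" where
  "cyclic_dist_le N s i j \<longleftrightarrow> (\<exists>d. \<bar>d\<bar> \<le> int s \<and> int N dvd int j - int i - d)"

lemma cyclic_dist_le_refl [simp]: "cyclic_dist_le N s i i"
  unfolding cyclic_dist_le_def by (rule exI[of _ 0]) simp

lemma cyclic_dist_le_sym: "cyclic_dist_le N s i j \<Longrightarrow> cyclic_dist_le N s j i"
proof -
  assume "cyclic_dist_le N s i j"
  then obtain d where d: "\<bar>d\<bar> \<le> int s" "int N dvd int j - int i - d"
    unfolding cyclic_dist_le_def by blast
  have "int N dvd - (int j - int i - d)" using d(2) by (simp only: dvd_minus_iff)
  also have "- (int j - int i - d) = int i - int j - (- d)" by simp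
  finally show ?thesis unfolding cyclic_dist_le_def using d(1) by (intro exI[of _ "- d"]) simp
qed

lemma cyclic_dist_le_trans:
  assumes "cyclic_dist_le N s i j" "cyclic_dist_le N t j k"
  shows "cyclic_dist_le N (s + t) i k"
proof -
  obtain d e where d: "\<bar>d\<bar> \<le> int s" "int N dvd int j - int i - d"
    and e: "\<bar>e\<bar> \<le> int t" "int N dvd int k - int j - e"
    using assms unfolding cyclic_dist_le_def by blast
  have "int N dvd (int j - int i - d) + (int k - int j - e)" using d(2) e(2) by (rule dvd_add)
  also have "\<dots> = int k - int i - (d + e)" by simp
  finally show ?thesis
    unfolding cyclic_dist_le_def using d(1) e(1) by (intro exI[of _ "d + e"]) simp
qed

lemma cyclic_dist_le_Suc: "cyclic_dist_le N 1 i (Suc i)"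
  unfolding cyclic_dist_le_def by (rule exI[of _ 1]) simp

lemma cyclic_dist_le_Suc_mod: "cyclic_dist_le N 1 i (Suc i mod N)"
proof -
  have "int N dvd int (Suc i mod N) - int (Suc i)"
    by (simp add: of_nat_mod mod_eq_dvd_iff[symmetric])
  thus ?thesis unfolding cyclic_dist_le_def by (intro exI[of _ 1]) (simp add: algebra_simps)
qed

lemma cyclic_dist_le_shift:
  assumes "cyclic_dist_le N s i j" "i < N" "j < N" "i \<noteq> j"
  obtains e where "1 \<le> e" "e \<le> s" "i + e = j \<or> i + e = N + j"
  | e where "1 \<le> e" "e \<le> s" "j + e = i \<or> j + e = N + i"
proof -
  have shift: "\<exists>e\<ge>1. e \<le> s \<and> (i + e = j \<or> i + e = N + j)"
    if "0 \<le> d" "d \<le> int s" "int N dvd int j - int i - d" "i < N" "j < N" "i \<noteq> j" for d i j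
  proof -
    define e where "e = (if i < j then j - i else N + j - i)"
    have "int e - d = (int j - int i - d) + int N * (if i < j then 0 else 1)"
      using that(4-6) by (auto simp: e_def of_nat_diff)
    hence "int N dvd int e - d" using that(3) by (simp only: dvd_add dvd_triv_left)
    hence "int e mod int N = d mod int N" by (simp add: mod_eq_dvd_iff)
    moreover have "e < N" using that(4-6) by (auto simp: e_def)
    ultimately have "int e \<le> d" using that(1,4) zmod_le_nonneg_dividend[of d "int N"] by simp
    thus ?thesis using that by (intro exI[of _ e]) (auto simp: e_def)
  qed
  obtain d where d: "\<bar>d\<bar> \<le> int s" "int N dvd int j - int i - d"
    using assms(1) unfolding cyclic_dist_le_def by blast
  show thesis
  proof (cases "0 \<le> d")
    case True
    thus ?thesis using shift[of d j i] d assms that(1) by auto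
  next
    case False
    have "int N dvd - (int j - int i - d)" using d(2) by (simp only: dvd_minus_iff)
    also have "- (int j - int i - d) = int i - int j - (- d)" by simp
    finally show ?thesis using shift[of "- d" i j] d(1) False assms that(2) by auto
  qed
qed

definition cyclic_coloring :: "nat list \<Rightarrow> nat list \<Rightarrow> bool" where
  "cyclic_coloring S w \<longleftrightarrow> set w \<subseteq> {..<length S} \<and>
     (\<forall>i<length w. \<forall>j<length w. i \<noteq> j \<longrightarrow> w ! i = w ! j \<longrightarrow>
        \<not> cyclic_dist_le (length w) (S ! (w ! i)) i j)"

primrec spaced :: "nat list \<Rightarrow> nat list \<Rightarrow> bool" where
  "spaced S [] \<longleftrightarrow> True"
| "spaced S (x # w) \<longleftrightarrow> x \<notin> set (take (S ! x) w) \<and> spaced S w"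

lemma spaced_nth:
  assumes "spaced S w" "i + e < length w" "1 \<le> e" "e \<le> S ! (w ! i)"
  shows "w ! (i + e) \<noteq> w ! i"
  using assms
proof (induction w arbitrary: i)
  case (Cons x w)
  show ?case
  proof (cases i)
    case 0
    have "w ! (e - 1) \<in> set (take (S ! x) w)"
      using Cons.prems 0 by (auto simp: in_set_conv_nth intro!: exI[of _ "e - 1"])
    thus ?thesis using Cons.prems 0 by (auto simp: nth_Cons')
  next
    case (Suc k)
    thus ?thesis using Cons.prems Cons.IH[of k] by simp
  qed
qed simp

text \<open>
  A colour occurring only as the last letter of \<open>w\<close> may be used for an arbitrarily large distance;
  hence \<open>S\<close> and \<open>T\<close> need not agree on it.
\<close>

lemma cyclic_coloring_if_spaced:
  assumes "spaced T (w @ w)" "set w \<subseteq> {..<length S}" "\<And>x. x \<in> set (butlast w) \<Longrightarrow> T ! x = S ! x"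
  shows "cyclic_coloring S w"
  unfolding cyclic_coloring_def
proof (intro conjI allI impI notI)
  fix i j
  assume ij: "i < length w" "j < length w" "i \<noteq> j" "w ! i = w ! j"
    and near: "cyclic_dist_le (length w) (S ! (w ! i)) i j"
  have "i < length (butlast w) \<or> j < length (butlast w)" using ij by auto
  hence "w ! i \<in> set (butlast w)" using ij(4) by (metis nth_butlast nth_mem)
  hence S: "S ! (w ! i) = T ! (w ! i)" using assms(3) by simp
  have nth: "(w @ w) ! k = w ! k" "(w @ w) ! (length w + k) = w ! k" if "k < length w" for k
    using that by (simp_all add: nth_append)
  have no_repeat: False if e: "1 \<le> e" "e \<le> S ! (w ! i)" and kl: "k < length w" "l < length w"
    "w ! k = w ! i" "w ! l = w ! i" "k + e = l \<or> k + e = length w + l" for e k l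
  proof -
    have "(w @ w) ! (k + e) = w ! i" using kl(5)
      by (elim disjE) (simp_all only: nth[OF kl(2)] kl(4))
    moreover have "k + e < length (w @ w)" using kl(2,5) by auto
    moreover have "e \<le> T ! ((w @ w) ! k)" using e(2) S nth(1)[OF kl(1)] kl(3) by simp
    ultimately show False
      using spaced_nth[OF assms(1), of k e] e(1) nth(1)[OF kl(1)] kl(3) by simp
  qed
  from cyclic_dist_le_shift[OF near ij(1-3)] show False
  proof cases
    case (1 e)
    thus ?thesis by (rule no_repeat[OF _ _ ij(1,2) refl ij(4)[symmetric]])
  next
    case (2 e)
    thus ?thesis by (rule no_repeat[OF _ _ ij(2,1) ij(4)[symmetric] refl])
  qed
qed (use assms(2) in blast)

lemma concat_append_induct:
  assumes "P r" "\<And>b r. b \<in> set bs \<Longrightarrow> P r \<Longrightarrow> P (b @ r)"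
  shows "P (concat bs @ r)"
  using assms(2) by (induction bs) (auto intro: assms(1))

text \<open>
  The invariant \<open>P r\<close> states what the blocks require of the letters that follow them.
\<close>

lemma spaced_concat_square:
  assumes "P []" "\<And>b r. b \<in> set bs \<Longrightarrow> P r \<Longrightarrow> P (b @ r)"
    and "\<And>b r. b \<in> set bs \<Longrightarrow> P r \<Longrightarrow> spaced S r \<Longrightarrow> spaced S (b @ r)"
  shows "spaced S (concat bs @ concat bs)"
  using concat_append_induct[of "\<lambda>r. P r \<and> spaced S r" "[]" "bs @ bs"] assms by auto

lemma notin_set_take_mono: "x \<notin> set (take n w) \<Longrightarrow> m \<le> n \<Longrightarrow> x \<notin> set (take m w)"
  by (meson set_take_subset_set_take subsetD)

lemma ex_cyclic_coloring_113k:
  "\<exists>w. length w = N \<and> cyclic_coloring [1, 1, 3, k] w \<and> 2 \<notin> set w"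
proof -
  define pairs :: "nat list list" where "pairs = replicate (N div 2) [0, 1]"
  define bs where "bs = pairs @ (if even N then [] else [[3]])"
  have bs: "b = [0, 1] \<or> b = [3]" if "b \<in> set bs" for b
    using that by (auto simp: bs_def pairs_def split: if_splits)
  have len: "length (concat bs) = N"
    by (auto simp: bs_def pairs_def length_concat sum_list_replicate; presburger)
  have set: "set (concat bs) \<subseteq> {0, 1, 3}" using bs by fastforce
  have last: "set (butlast (concat bs)) \<subseteq> {0, 1}"
    by (auto simp: bs_def pairs_def butlast_append dest!: in_set_butlastD)
  have "spaced [1, 1, 3, 0] (concat bs @ concat bs)"
  proof (rule spaced_concat_square[of "\<lambda>r. 1 \<notin> set (take 1 r)"])
    fix b r assume "b \<in> set bs" "(1::nat) \<notin> set (take 1 r)"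
    thus "1 \<notin> set (take 1 (b @ r))" using bs by fastforce
  next
    fix b r assume "b \<in> set bs" "1 \<notin> set (take 1 r)" "spaced [1, 1, 3, 0] r"
    thus "spaced [1, 1, 3, 0] (b @ r)" using bs by fastforce
  qed simp
  hence "cyclic_coloring [1, 1, 3, k] (concat bs)"
    by (rule cyclic_coloring_if_spaced) (use set last in auto)
  thus ?thesis using len set by (intro exI[of _ "concat bs"]) auto
qed

lemma block_decomposition:
  fixes N :: nat
  assumes "3 \<le> N" "N \<noteq> 5"
  shows "\<exists>a b. N = 3 * a + 4 * b"
proof -
  obtain q r where N: "N = 3 * q + r" "r < 3"
    using mult_div_mod_eq[of 3 N] mod_less_divisor[of 3 N] by (metis zero_less_numeral)
  hence "r \<le> q" using assms by presburger
  hence "N = 3 * (q - r) + 4 * r" using N(1) by simp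
  thus ?thesis by blast
qed

lemma ex_block_concat:
  assumes "3 \<le> N" "N \<noteq> 5" "length x = 3" "length y = 4"
  shows "\<exists>bs. set bs \<subseteq> {x, y} \<and> length (concat bs) = N"
proof -
  obtain a b where N: "N = 3 * a + 4 * b" using block_decomposition[OF assms(1,2)] by blast
  have "length (concat (replicate a x @ replicate b y)) = N"
    using N assms(3,4) by (simp add: length_concat sum_list_replicate)
  thus ?thesis by (intro exI[of _ "replicate a x @ replicate b y"]) auto
qed

lemma ex_cyclic_coloring_1223:
  assumes "3 \<le> N" "N \<noteq> 5"
  shows "\<exists>w. length w = N \<and> cyclic_coloring [1, 2, 2, 3] w \<and> 3 \<notin> set w"
proof -
  obtain bs :: "nat list list"
    where bs: "set bs \<subseteq> {[0, 1, 2], [0, 1, 0, 2]}" "length (concat bs) = N"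
    using ex_block_concat[OF assms, of "[0, 1, 2::nat]" "[0, 1, 0, 2]"] by auto
  have "spaced [1, 2, 2, 3] (concat bs @ concat bs)"
  proof (rule spaced_concat_square[of "\<lambda>r. 1 \<notin> set (take 1 r) \<and> 2 \<notin> set (take 2 r)"])
    fix b and r :: "nat list"
    assume "b \<in> set bs"
    then consider "b = [0, 1, 2]" | "b = [0, 1, 0, 2]" using bs by blast
    note block = this
    from block show "1 \<notin> set (take 1 (b @ r)) \<and> 2 \<notin> set (take 2 (b @ r))" by cases auto
    assume "1 \<notin> set (take 1 r) \<and> 2 \<notin> set (take 2 r)" "spaced [1, 2, 2, 3] r"
    with block show "spaced [1, 2, 2, 3] (b @ r)" by cases auto
  qed simp
  moreover have set: "set (concat bs) \<subseteq> {0, 1, 2}" using bs(1) by fastforce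
  ultimately have "cyclic_coloring [1, 2, 2, 3] (concat bs)"
    by (intro cyclic_coloring_if_spaced) auto
  thus ?thesis using bs(2) set by (intro exI[of _ "concat bs"]) auto
qed

lemma ex_cyclic_coloring_22223:
  assumes "3 \<le> N" "N \<noteq> 5"
  shows "\<exists>w. length w = N \<and> cyclic_coloring [2, 2, 2, 2, 3] w \<and> 4 \<notin> set w"
proof -
  let ?P = "\<lambda>r::nat list. 1 \<notin> set (take 1 r) \<and> 2 \<notin> set (take 2 r) \<and> 3 \<notin> set (take 2 r)"
  obtain bs :: "nat list list"
    where bs: "set bs \<subseteq> {[0, 1, 2], [0, 1, 2, 3]}" "length (concat bs) = N"
    using ex_block_concat[OF assms, of "[0, 1, 2::nat]" "[0, 1, 2, 3]"] by auto
  have "spaced [2, 2, 2, 2, 3] (concat bs @ concat bs)"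
  proof (rule spaced_concat_square[of ?P])
    fix b r
    assume "b \<in> set bs"
    then consider "b = [0, 1, 2]" | "b = [0, 1, 2, 3]" using bs by blast
    note block = this
    from block show "?P (b @ r)" by cases auto
    assume r: "?P r" "spaced [2, 2, 2, 2, 3] r"
    hence "2 \<notin> set (take 1 r)" using notin_set_take_mono[of 2 2 r 1] by simp
    with block r show "spaced [2, 2, 2, 2, 3] (b @ r)" by cases auto
  qed simp
  moreover have set: "set (concat bs) \<subseteq> {0, 1, 2, 3}" using bs(1) by fastforce
  ultimately have "cyclic_coloring [2, 2, 2, 2, 3] (concat bs)"
    by (intro cyclic_coloring_if_spaced) auto
  thus ?thesis using bs(2) set by (intro exI[of _ "concat bs"]) auto
qed

lemma ex_cyclic_coloring_12345k:
  "\<exists>w. length w = N \<and> cyclic_coloring [1, 2, 3, 4, 5, k] w \<and> 2 \<notin> set w"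
proof -
  let ?P = "\<lambda>r::nat list. 1 \<notin> set (take 1 r) \<and> 3 \<notin> set (take 3 r) \<and> 4 \<notin> set (take 5 r)"
  define period :: "nat list" where "period = [0, 1, 0, 3, 0, 1, 0, 4]"
  define periods where "periods = replicate (N div 8) period"
  define bs where
    "bs = periods @ (if N mod 8 = 0 then [] else [take (N mod 8 - 1) period @ [5]])"
  have len: "length (concat bs) = N"
    by (auto simp: bs_def periods_def period_def length_concat sum_list_replicate; presburger)
  have set: "set (concat bs) \<subseteq> {0, 1, 3, 4, 5}"
    by (auto simp: bs_def periods_def period_def dest!: in_set_takeD)
  have last: "set (butlast (concat bs)) \<subseteq> {0, 1, 3, 4}"
    by (auto simp: bs_def periods_def period_def butlast_append dest!: in_set_butlastD in_set_takeD)
  define ends where "ends = map (\<lambda>n. take n period @ [5]) [0..<7]"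
  have ends: "ends = [[5], [0, 5], [0, 1, 5], [0, 1, 0, 5], [0, 1, 0, 3, 5], [0, 1, 0, 3, 0, 5],
      [0, 1, 0, 3, 0, 1, 5]]"
    by (simp add: ends_def period_def upt_rec)
  have bs: "b = period \<or> b \<in> set ends" if "b \<in> set bs" for b
    using that by (auto simp: bs_def periods_def ends_def split: if_splits)
  have "spaced [1, 2, 3, 4, 5, 0] (concat bs @ concat bs)"
  proof (rule spaced_concat_square[of ?P])
    fix b r assume b: "b \<in> set bs" and r: "?P r"
    have three: "3 \<notin> set (take 3 r)" and four: "4 \<notin> set (take 5 r)" using r by simp_all
    have later_three: "3 \<notin> set (take 1 r)" "3 \<notin> set (take 2 r)"
      by (rule notin_set_take_mono[OF three], simp)+
    have later_four: "4 \<notin> set (take 1 r)" "4 \<notin> set (take 2 r)" "4 \<notin> set (take 3 r)"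
      "4 \<notin> set (take 4 r)"
      by (rule notin_set_take_mono[OF four], simp)+
    note later = r[simplified] later_three[simplified] later_four[simplified]
    show "?P (b @ r)" using bs[OF b] by (auto simp: period_def ends later)
    assume "spaced [1, 2, 3, 4, 5, 0] r"
    thus "spaced [1, 2, 3, 4, 5, 0] (b @ r)"
      using bs[OF b] by (auto simp: period_def ends later)
  qed simp
  hence "cyclic_coloring [1, 2, 3, 4, 5, k] (concat bs)"
    by (rule cyclic_coloring_if_spaced) (use set last in auto)
  thus ?thesis using len set by (intro exI[of _ "concat bs"]) auto
qed

section \<open>Packing colourings of an adjacency relation\<close>

locale simple_adjacency =
  fixes adj :: "'a \<Rightarrow> 'a \<Rightarrow> bool"
  assumes adj_sym: "adj u w \<Longrightarrow> adj w u"
    and adj_irrefl: "\<not> adj u u"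
begin

definition nbs :: "'a \<Rightarrow> 'a set" where
  "nbs u = {w. adj u w}"

primrec dist_le :: "nat \<Rightarrow> 'a \<Rightarrow> 'a \<Rightarrow> bool" where
  "dist_le 0 u w \<longleftrightarrow> u = w"
| "dist_le (Suc s) u w \<longleftrightarrow> dist_le s u w \<or> (\<exists>x. adj u x \<and> dist_le s x w)"

definition separated :: "nat \<Rightarrow> 'a set \<Rightarrow> bool" where
  "separated s E \<longleftrightarrow> pairwise (\<lambda>u w. \<not> dist_le s u w) E"

definition adj_closed :: "'a set \<Rightarrow> bool" where
  "adj_closed Z \<longleftrightarrow> (\<forall>u\<in>Z. nbs u \<subseteq> Z)"

definition packing_coloring :: "nat list \<Rightarrow> 'a set \<Rightarrow> ('a \<Rightarrow> nat) \<Rightarrow> bool" where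
  "packing_coloring S Z c \<longleftrightarrow> (\<forall>u\<in>Z. c u < length S \<and>
     (\<forall>w\<in>Z. u \<noteq> w \<longrightarrow> c u = c w \<longrightarrow> \<not> dist_le (S ! c u) u w))"

definition pack_colorable_on :: "nat list \<Rightarrow> 'a set \<Rightarrow> bool" where
  "pack_colorable_on S Z \<longleftrightarrow> (\<exists>c. packing_coloring S Z c)"

lemma in_nbs [simp]: "w \<in> nbs u \<longleftrightarrow> adj u w"
  by (simp add: nbs_def)

lemma adj_commute: "adj u w \<longleftrightarrow> adj w u"
  using adj_sym by blast

lemma adj_iff_two: "nbs u = {x, y} \<Longrightarrow> adj u w \<longleftrightarrow> w = x \<or> w = y"
  using in_nbs[of w u] by simp

lemma adj_iff_three: "nbs u = {x, y, z} \<Longrightarrow> adj u w \<longleftrightarrow> w = x \<or> w = y \<or> w = z"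
  using in_nbs[of w u] by simp

lemma dist_le_mono: "s \<le> t \<Longrightarrow> dist_le s u w \<Longrightarrow> dist_le t u w"
  by (induction rule: dec_induct) auto

lemma dist_le_snoc: "dist_le s u x \<Longrightarrow> adj x w \<Longrightarrow> dist_le (Suc s) u w"
  by (induction s arbitrary: u) auto

lemma dist_le_sym: "dist_le s u w \<Longrightarrow> dist_le s w u"
proof (induction s arbitrary: u)
  case (Suc s)
  thus ?case using dist_le_snoc adj_sym by (metis dist_le.simps(2))
qed auto

lemma dist_le_1_iff: "dist_le 1 u w \<longleftrightarrow> u = w \<or> adj u w"
  by auto

lemma dist_le_2_iff: "dist_le 2 u w \<longleftrightarrow> u = w \<or> adj u w \<or> (\<exists>x. adj u x \<and> adj x w)"
  by (auto simp: numeral_2_eq_2)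

lemma dist_le_3_iff:
  "dist_le 3 u w \<longleftrightarrow> u = w \<or> adj u w \<or> (\<exists>x y. adj u x \<and> (x = y \<or> adj x y) \<and> adj y w)"
  by (auto simp: numeral_3_eq_3)

lemma separatedD: "separated s E \<Longrightarrow> u \<in> E \<Longrightarrow> w \<in> E \<Longrightarrow> dist_le s u w \<Longrightarrow> u = w"
  unfolding separated_def pairwise_def by blast

lemma separated_antimono: "separated t E \<Longrightarrow> s \<le> t \<Longrightarrow> separated s E"
  unfolding separated_def using dist_le_mono by (blast intro: pairwise_mono)

lemma ex_maximal_separated_subset:
  assumes "finite Q"
  obtains E where "E \<subseteq> Q" "separated s E" "\<And>q. q \<in> Q \<Longrightarrow> \<exists>e\<in>E. dist_le s q e"
proof -
  let ?F = "{F. F \<subseteq> Q \<and> separated s F}"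
  have "finite ?F" using assms by (intro finite_subset[of ?F "Pow Q"]) auto
  moreover have "{} \<in> ?F" by (simp add: separated_def)
  ultimately obtain E where E: "E \<in> ?F" and max: "\<And>F. F \<in> ?F \<Longrightarrow> E \<subseteq> F \<Longrightarrow> E = F"
    using finite_has_maximal[of ?F] by (metis (no_types, lifting) empty_iff)
  have "\<exists>e\<in>E. dist_le s q e" if "q \<in> Q" for q
  proof (rule ccontr)
    assume far: "\<not> ?thesis"
    hence "\<not> dist_le s e q" if "e \<in> E" for e using dist_le_sym that by blast
    hence "insert q E \<in> ?F" using E that far by (auto simp: separated_def pairwise_insert)
    hence "q \<in> E" using max by blast
    thus False using far dist_le_mono[of 0 s q q] by auto
  qed
  thus ?thesis using that[of E] E by blast
qed

lemma adj_closedD: "adj_closed Z \<Longrightarrow> u \<in> Z \<Longrightarrow> adj u w \<Longrightarrow> w \<in> Z"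
  unfolding adj_closed_def using in_nbs by blast

lemma adj_closed_Diff: "adj_closed X \<Longrightarrow> adj_closed Z \<Longrightarrow> adj_closed (X - Z)"
  using adj_sym by (fastforce simp: adj_closed_def)

lemma dist_le_in_adj_closed: "adj_closed Z \<Longrightarrow> dist_le s u w \<Longrightarrow> u \<in> Z \<Longrightarrow> w \<in> Z"
  by (induction s arbitrary: u) (auto dest: adj_closedD)

lemma pack_colorable_on_Un:
  assumes "adj_closed Y" "adj_closed Z" "Y \<inter> Z = {}"
    and "pack_colorable_on S Y" "pack_colorable_on S Z"
  shows "pack_colorable_on S (Y \<union> Z)"
proof -
  obtain c d where c: "packing_coloring S Y c" and d: "packing_coloring S Z d"
    using assms(4,5) unfolding pack_colorable_on_def by blast
  have "\<not> dist_le s u w" if "u \<in> Y" "w \<in> Z" for s u w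
    using that dist_le_in_adj_closed[OF assms(1), of s u w] assms(3) by blast
  moreover have "\<not> dist_le s u w" if "u \<in> Z" "w \<in> Y" for s u w
    using that dist_le_in_adj_closed[OF assms(2), of s u w] assms(3) by blast
  moreover have "u \<notin> Y" if "u \<in> Z" for u using that assms(3) by blast
  ultimately have "packing_coloring S (Y \<union> Z) (\<lambda>u. if u \<in> Y then c u else d u)"
    using c d unfolding packing_coloring_def by auto
  thus ?thesis unfolding pack_colorable_on_def by blast
qed

lemma pack_colorable_on_if_pieces:
  assumes "finite X" "adj_closed X"
    and "\<And>Y. Y \<subseteq> X \<Longrightarrow> adj_closed Y \<Longrightarrow> Y \<noteq> {} \<Longrightarrow>
      \<exists>Z\<subseteq>Y. Z \<noteq> {} \<and> adj_closed Z \<and> pack_colorable_on S Z"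
  shows "pack_colorable_on S X"
  using assms
proof (induction "card X" arbitrary: X rule: less_induct)
  case less
  show ?case
  proof (cases "X = {}")
    case True thus ?thesis by (simp add: pack_colorable_on_def packing_coloring_def)
  next
    case False
    then obtain Z where Z: "Z \<subseteq> X" "Z \<noteq> {}" "adj_closed Z" "pack_colorable_on S Z"
      using less.prems by blast
    have diff: "adj_closed (X - Z)" using less.prems(2) Z(3) by (rule adj_closed_Diff)
    moreover have "card (X - Z) < card X"
      using Z less.prems(1) by (intro psubset_card_mono) auto
    moreover have "\<exists>Z'\<subseteq>Y. Z' \<noteq> {} \<and> adj_closed Z' \<and> pack_colorable_on S Z'"
      if "Y \<subseteq> X - Z" "adj_closed Y" "Y \<noteq> {}" for Y
      using less.prems(3)[of Y] that by blast
    ultimately have "pack_colorable_on S (X - Z)"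
      using less.prems(1) by (intro less.hyps) auto
    hence "pack_colorable_on S (Z \<union> (X - Z))"
      using Z diff by (intro pack_colorable_on_Un) auto
    moreover have "Z \<union> (X - Z) = X" using Z by blast
    ultimately show ?thesis by simp
  qed
qed

lemma pack_colorable_on_list:
  assumes len: "length cs = length xs" and cs: "set cs \<subseteq> {..<length S}"
    and wrt: "sorted_wrt (\<lambda>(x, i) (y, j). i = j \<longrightarrow> \<not> dist_le (S ! i) x y) (zip xs cs)"
  shows "pack_colorable_on S (set xs)"
proof -
  have "\<exists>i<length xs. xs ! i = x" if "x \<in> set xs" for x using that by (simp add: in_set_conv_nth)
  then obtain ix where ix: "\<And>x. x \<in> set xs \<Longrightarrow> ix x < length xs \<and> xs ! ix x = x" by metis
  have lt: "\<not> dist_le (S ! (cs ! i)) (xs ! i) (xs ! j)"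
    if "i < j" "j < length xs" "cs ! i = cs ! j" for i j
    using sorted_wrt_nth_less[OF wrt, of i j] that len by simp
  have "\<not> dist_le (S ! (cs ! ix x)) x y"
    if xy: "x \<in> set xs" "y \<in> set xs" "x \<noteq> y" "cs ! ix x = cs ! ix y" for x y
  proof -
    consider "ix x < ix y" | "ix y < ix x" using ix xy(1-3) by (metis linorder_neqE_nat)
    thus ?thesis
    proof cases
      case 1
      thus ?thesis using lt[of "ix x" "ix y"] ix[OF xy(1)] ix[OF xy(2)] xy(4) by metis
    next
      case 2
      thus ?thesis using lt[of "ix y" "ix x"] ix[OF xy(1)] ix[OF xy(2)] xy(4) dist_le_sym by metis
    qed
  qed
  moreover have "cs ! ix x < length S" if "x \<in> set xs" for x
    using ix[OF that] cs len nth_mem[of "ix x" cs] by (auto simp: subset_iff)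
  ultimately have "packing_coloring S (set xs) (\<lambda>x. cs ! ix x)"
    unfolding packing_coloring_def by blast
  thus ?thesis unfolding pack_colorable_on_def by blast
qed

section \<open>Vertex sets that wind around a cycle\<close>

definition cyclic_map :: "nat \<Rightarrow> ('a \<Rightarrow> nat) \<Rightarrow> 'a set \<Rightarrow> bool" where
  "cyclic_map N \<phi> Z \<longleftrightarrow>
     (\<forall>u\<in>Z. \<phi> u < N \<and> (\<forall>w. adj u w \<longrightarrow> cyclic_dist_le N 1 (\<phi> u) (\<phi> w)))"

definition almost_cyclic :: "nat \<Rightarrow> 'a set \<Rightarrow> bool" where
  "almost_cyclic N Z \<longleftrightarrow> (\<exists>E \<phi>. separated 3 E \<and> inj_on \<phi> (Z - E) \<and> cyclic_map N \<phi> Z)"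

lemma cyclic_dist_le_if_dist_le:
  assumes "adj_closed Z" "cyclic_map N \<phi> Z" "u \<in> Z" "dist_le s u w"
  shows "cyclic_dist_le N s (\<phi> u) (\<phi> w)"
  using assms(3,4)
proof (induction s arbitrary: u)
  case (Suc s)
  obtain x where x: "x = u \<or> adj u x" "dist_le s x w" using Suc.prems(2) by auto
  have "x \<in> Z" using x(1) Suc.prems(1) adj_closedD[OF assms(1)] by blast
  moreover have "cyclic_dist_le N 1 (\<phi> u) (\<phi> x)"
    using x(1) Suc.prems(1) assms(2) by (auto simp: cyclic_map_def)
  ultimately show ?case using cyclic_dist_le_trans[of N 1 _ _ s] Suc.IH[of x] x(2) by simp
qed simp

lemma pack_colorable_on_if_almost_cyclic:
  assumes Z: "adj_closed Z" "almost_cyclic N Z"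
    and w: "length w = N" "cyclic_coloring S w" and j: "j \<notin> set w" "j < length S" "S ! j \<le> 3"
  shows "pack_colorable_on S Z"
proof -
  obtain E \<phi> where E: "separated 3 E" and inj: "inj_on \<phi> (Z - E)" and \<phi>: "cyclic_map N \<phi> Z"
    using Z(2) unfolding almost_cyclic_def by blast
  have lt: "\<phi> u < length w" if "u \<in> Z" for u using \<phi> that w(1) by (simp add: cyclic_map_def)
  have letter: "w ! \<phi> u < length S" "w ! \<phi> u \<noteq> j" if "u \<in> Z" for u
    using nth_mem[OF lt[OF that]] w(2) j(1) by (auto simp: cyclic_coloring_def)
  define c where "c u = (if u \<in> E then j else w ! \<phi> u)" for u
  have "\<not> dist_le (S ! c u) u v" if uv: "u \<in> Z" "v \<in> Z" "u \<noteq> v" "c u = c v" for u v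
  proof (cases "u \<in> E")
    case True
    hence "v \<in> E" using uv letter by (auto simp: c_def split: if_splits)
    hence "\<not> dist_le 3 u v" using separatedD[OF E True] uv(3) by blast
    thus ?thesis using True dist_le_mono[OF j(3)] by (auto simp: c_def)
  next
    case False
    hence "v \<notin> E" using uv letter by (auto simp: c_def split: if_splits)
    hence "w ! \<phi> u = w ! \<phi> v" "\<phi> u \<noteq> \<phi> v"
      using False uv inj by (auto simp: c_def inj_on_def)
    hence "\<not> cyclic_dist_le N (S ! (w ! \<phi> u)) (\<phi> u) (\<phi> v)"
      using w lt uv(1,2) by (auto simp: cyclic_coloring_def)
    thus ?thesis using False cyclic_dist_le_if_dist_le[OF Z(1) \<phi> uv(1)] by (auto simp: c_def)
  qed
  moreover have "c u < length S" if "u \<in> Z" for u using letter[OF that] j(2) by (simp add: c_def)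
  ultimately have "packing_coloring S Z c" unfolding packing_coloring_def by blast
  thus ?thesis unfolding pack_colorable_on_def by blast
qed

section \<open>Components of maximum degree 2\<close>

definition path_in :: "'a set \<Rightarrow> 'a list \<Rightarrow> bool" where
  "path_in C p \<longleftrightarrow> successively adj p \<and> distinct p \<and> set p \<subseteq> C"

definition component_path :: "'a set \<Rightarrow> 'a list \<Rightarrow> bool" where
  "component_path C p \<longleftrightarrow> p \<noteq> [] \<and> path_in C p \<and> (\<forall>u\<in>set p. nbs u \<inter> C \<subseteq> set p) \<and>
     (\<forall>i<length p. \<forall>j<length p. adj (p ! i) (p ! j) \<longrightarrow>
        j = Suc i mod length p \<or> i = Suc j mod length p)"

definition max_degree_2_on :: "'a set \<Rightarrow> bool" where
  "max_degree_2_on C \<longleftrightarrow> finite C \<and> (\<forall>v\<in>C. card (nbs v \<inter> C) \<le> 2)"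

lemma path_in_interior_nbs:
  assumes C: "max_degree_2_on C" and p: "path_in C p" and i: "0 < i" "Suc i < length p"
  shows "nbs (p ! i) \<inter> C = {p ! (i - 1), p ! Suc i}"
proof -
  have p: "successively adj p" "distinct p" "set p \<subseteq> C" using p by (simp_all add: path_in_def)
  have "adj (p ! i) (p ! (i - 1))" "adj (p ! i) (p ! Suc i)"
    using successively_nth[OF p(1), of "i - 1"] successively_nth[OF p(1), of i] i adj_sym by auto
  moreover have mem: "p ! k \<in> C" if "k \<le> Suc i" for k using p(3) i that nth_mem[of k p] by auto
  ultimately have "{p ! (i - 1), p ! Suc i} \<subseteq> nbs (p ! i) \<inter> C" by auto
  moreover have "card {p ! (i - 1), p ! Suc i} = 2"
    using p(2) i by (simp add: nth_eq_iff_index_eq)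
  moreover have "card (nbs (p ! i) \<inter> C) \<le> 2" "finite (nbs (p ! i) \<inter> C)"
    using C mem by (simp_all add: max_degree_2_on_def)
  ultimately show ?thesis by (metis card_seteq)
qed

lemma longest_path_nbs_subset:
  assumes C: "max_degree_2_on C" and p: "path_in C p"
    and longest: "\<And>q. path_in C q \<Longrightarrow> length q \<le> length p"
    and u: "u \<in> set p"
  shows "nbs u \<inter> C \<subseteq> set p"
proof
  fix w assume w: "w \<in> nbs u \<inter> C"
  obtain i where i: "i < length p" "u = p ! i" using u by (auto simp: in_set_conv_nth)
  consider "0 < i" "Suc i < length p" | "u = hd p" | "u = last p"
    using i by (metis gr0I hd_conv_nth last_conv_nth list.size(3) not_less0 diff_Suc_1 Suc_lessI)
  thus "w \<in> set p"
  proof cases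
    case 1
    thus ?thesis using path_in_interior_nbs[OF C p 1] w i nth_mem[of _ p] by auto
  next
    case 2
    thus ?thesis
      using longest[of "w # p"] p w adj_sym by (fastforce simp: path_in_def successively_Cons)
  next
    case 3
    thus ?thesis
      using longest[of "p @ [w]"] p w by (fastforce simp: path_in_def successively_append_iff)
  qed
qed

lemma path_in_adj_imp_consecutive:
  assumes C: "max_degree_2_on C" and p: "path_in C p"
    and ij: "i < length p" "j < length p" "adj (p ! i) (p ! j)"
  shows "j = Suc i mod length p \<or> i = Suc j mod length p"
proof -
  have interior: "l = k - 1 \<or> l = Suc k"
    if k: "0 < k" "Suc k < length p" "l < length p" "adj (p ! k) (p ! l)" for k l
  proof -
    have "p ! l \<in> nbs (p ! k) \<inter> C" using k p nth_mem by (auto simp: path_in_def)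
    hence "p ! l = p ! (k - 1) \<or> p ! l = p ! Suc k"
      using path_in_interior_nbs[OF C p k(1,2)] by auto
    thus ?thesis using p k by (auto simp: path_in_def nth_eq_iff_index_eq)
  qed
  have "i \<noteq> j" using ij(3) adj_irrefl by metis
  then consider "0 < i" "Suc i < length p" | "0 < j" "Suc j < length p"
    | "i = 0" "Suc j = length p" | "j = 0" "Suc i = length p"
    using ij by linarith
  thus ?thesis
  proof cases
    case 1 thus ?thesis using interior[of i j] ij by auto
  next
    case 2 thus ?thesis using interior[of j i] ij adj_sym by auto
  qed auto
qed

lemma ex_component_path:
  assumes C: "max_degree_2_on C" "C \<noteq> {}"
  shows "\<exists>p. component_path C p"
proof -
  have "length q \<le> card C" if "path_in C q" for q
    using that C(1) unfolding path_in_def max_degree_2_on_def by (metis distinct_card card_mono)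
  moreover have "path_in C []" by (simp add: path_in_def)
  ultimately obtain p where p: "path_in C p" and longest: "\<And>q. path_in C q \<Longrightarrow> length q \<le> length p"
    using ex_has_greatest_nat[of "path_in C" "[]" length "Suc (card C)"] le_imp_less_Suc by metis
  obtain x where "x \<in> C" using C(2) by blast
  hence "p \<noteq> []" using longest[of "[x]"] by (auto simp: path_in_def)
  thus ?thesis unfolding component_path_def
    using p longest longest_path_nbs_subset[OF C(1)] path_in_adj_imp_consecutive[OF C(1)]
    by (intro exI[of _ p]) blast
qed

definition closes_up :: "'a list \<Rightarrow> bool" where
  "closes_up p \<longleftrightarrow> 3 \<le> length p \<and> adj (last p) (hd p)"

text \<open>
  For a path that does not close up, any value that is at least 3, at least \<open>length p\<close> and not 5
  would do.
\<close>

definition winding_length :: "'a list \<Rightarrow> nat" where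
  "winding_length p = (if closes_up p then length p else length p + 6)"

lemma winding_length_bounds: "3 \<le> winding_length p" "length p \<le> winding_length p"
  by (auto simp: winding_length_def closes_up_def)

lemma component_path_cyclic_dist_le:
  assumes p: "component_path C p" and ij: "i < length p" "j < length p" "adj (p ! i) (p ! j)"
  shows "cyclic_dist_le (winding_length p) 1 i j"
proof -
  have step: "cyclic_dist_le (winding_length p) 1 i j"
    if ij: "i < length p" "j < length p" "adj (p ! i) (p ! j)" "j = Suc i mod length p" for i j
  proof (cases "closes_up p")
    case True
    thus ?thesis using ij(4) cyclic_dist_le_Suc_mod by (simp add: winding_length_def)
  next
    case False
    consider "j = Suc i" | "Suc i = length p" "j = 0"
      using ij(1,4) by (cases "Suc i = length p") auto
    thus ?thesis
    proof cases
      case 1 thus ?thesis using cyclic_dist_le_Suc by simp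
    next
      case 2
      hence "last p = p ! i" "hd p = p ! j"
        by (cases p; simp add: last_conv_nth flip: 2(1))+
      hence "length p < 3" using False ij(3) by (simp add: closes_up_def)
      moreover have "i \<noteq> j" using ij(3) adj_irrefl by metis
      ultimately have "i = Suc j" using 2 by linarith
      thus ?thesis using cyclic_dist_le_Suc cyclic_dist_le_sym by blast
    qed
  qed
  have "j = Suc i mod length p \<or> i = Suc j mod length p"
    using p ij unfolding component_path_def by blast
  thus ?thesis using step[of i j] step[of j i] ij adj_sym cyclic_dist_le_sym by blast
qed

section \<open>Retraction onto a core\<close>

definition dominated :: "'a \<Rightarrow> bool" where
  "dominated q \<longleftrightarrow> nbs q \<noteq> {} \<and> (\<exists>r. r \<noteq> q \<and> nbs q \<subseteq> insert r (nbs r))"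

definition twins :: "'a \<Rightarrow> 'a \<Rightarrow> bool" where
  "twins u w \<longleftrightarrow> nbs u - {w} = nbs w - {u}"

lemma twins_sym: "twins u w \<Longrightarrow> twins w u"
  by (simp add: twins_def)

lemma twins_adj: "twins u w \<Longrightarrow> adj u v \<Longrightarrow> v \<noteq> w \<Longrightarrow> adj w v"
  by (auto simp: twins_def set_eq_iff)

lemma twins_trans:
  assumes "twins u v" "twins v w"
  shows "twins u w"
proof -
  have nbs_subset: "nbs u - {w} \<subseteq> nbs w - {u}" if "twins u v" "twins v w" for u w
  proof
    fix x assume "x \<in> nbs u - {w}"
    hence x: "adj u x" "x \<noteq> w" by simp_all
    have "adj w x"
    proof (cases "x = v \<and> u \<noteq> w")
      case True
      hence "adj w u" using that x adj_sym twins_adj by metis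
      thus ?thesis using True that x adj_sym twins_adj by metis
    next
      case False
      thus ?thesis using that x twins_adj by metis
    qed
    thus "x \<in> nbs w - {u}" using x adj_irrefl by auto
  qed
  show ?thesis unfolding twins_def
    using nbs_subset[OF assms] nbs_subset[OF twins_sym[OF assms(2)] twins_sym[OF assms(1)]]
    by (rule equalityI)
qed

lemma dominated_if_twins:
  assumes "twins q r" "q \<noteq> r" "nbs q \<noteq> {}"
  shows "dominated q"
proof -
  have "nbs q \<subseteq> insert r (nbs r)" unfolding nbs_def using twins_adj[OF assms(1)] by blast
  thus ?thesis unfolding dominated_def using assms(2,3) by metis
qed

definition retraction :: "'a set \<Rightarrow> 'a set \<Rightarrow> ('a \<Rightarrow> 'a) \<Rightarrow> bool" where
  "retraction X C \<rho> \<longleftrightarrow> \<rho> ` X \<subseteq> C \<and> (\<forall>u\<in>C. \<rho> u = u) \<and>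
     (\<forall>u w. adj u w \<longrightarrow> \<rho> u = \<rho> w \<or> adj (\<rho> u) (\<rho> w))"

lemma ex_retraction_if_dominated:
  assumes X: "adj_closed X" and E: "E \<subseteq> X" "separated 2 E" "\<And>e. e \<in> E \<Longrightarrow> dominated e"
  shows "\<exists>\<rho>. retraction X (X - E) \<rho>"
proof -
  have "\<exists>r\<in>X - E. nbs e \<subseteq> insert r (nbs r)" if e: "e \<in> E" for e
  proof -
    obtain r x where r: "r \<noteq> e" "nbs e \<subseteq> insert r (nbs r)" and x: "adj e x"
      using E(3)[OF e] in_nbs unfolding dominated_def by (metis ex_in_conv)
    have rx: "x = r \<or> adj x r" using r(2) x adj_sym by auto
    have "r \<in> X" using rx x e E(1) adj_closedD[OF X] by blast
    moreover have "dist_le 2 e r" using rx x by (auto simp: dist_le_2_iff)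
    hence "r \<notin> E" using separatedD[OF E(2) e] r(1) by blast
    ultimately show ?thesis using r(2) by blast
  qed
  then obtain r where r: "\<And>e. e \<in> E \<Longrightarrow> r e \<in> X - E"
      "\<And>e. e \<in> E \<Longrightarrow> nbs e \<subseteq> insert (r e) (nbs (r e))"
    by metis
  define \<rho> where "\<rho> u = (if u \<in> E then r u else u)" for u
  have "\<rho> u = \<rho> w \<or> adj (\<rho> u) (\<rho> w)" if uw: "adj u w" for u w
  proof -
    have "\<not> (u \<in> E \<and> w \<in> E)"
      using uw separatedD[OF E(2), of u w] adj_irrefl dist_le_2_iff by metis
    moreover have "w = r u \<or> adj (r u) w" if "u \<in> E" using r(2)[OF that] uw in_nbs by blast
    moreover have "u = r w \<or> adj (r w) u" if "w \<in> E" using r(2)[OF that] uw adj_sym in_nbs by blast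
    ultimately show ?thesis using uw adj_sym unfolding \<rho>_def by metis
  qed
  moreover have "\<rho> ` X \<subseteq> X - E" using r(1) by (auto simp: \<rho>_def)
  ultimately show ?thesis unfolding retraction_def by (intro exI[of _ \<rho>]) (auto simp: \<rho>_def)
qed

lemma adj_closed_retraction_preimage:
  assumes \<rho>: "retraction X C \<rho>" and X: "adj_closed X" and P: "\<And>u. u \<in> P \<Longrightarrow> nbs u \<inter> C \<subseteq> P"
  shows "adj_closed {u \<in> X. \<rho> u \<in> P}"
  unfolding adj_closed_def
proof (intro ballI subsetI)
  fix u w assume u: "u \<in> {u \<in> X. \<rho> u \<in> P}" and "w \<in> nbs u"
  hence uw: "adj u w" by simp
  hence w: "w \<in> X" using u adj_closedD[OF X] by blast
  have "\<rho> w \<in> C" using \<rho> w by (auto simp: retraction_def)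
  moreover have "\<rho> u = \<rho> w \<or> \<rho> w \<in> nbs (\<rho> u)" using \<rho> uw by (simp add: retraction_def)
  ultimately have "\<rho> w \<in> P" using P[of "\<rho> u"] u by auto
  thus "w \<in> {u \<in> X. \<rho> u \<in> P}" using w by simp
qed

lemma ex_cyclic_map_retraction_preimage:
  assumes \<rho>: "retraction X C \<rho>" and X: "adj_closed X" and p: "component_path C p"
  shows "\<exists>\<phi>. cyclic_map (winding_length p) \<phi> {u \<in> X. \<rho> u \<in> set p} \<and> inj_on \<phi> (set p)"
proof -
  let ?Z = "{u \<in> X. \<rho> u \<in> set p}"
  have closed: "adj_closed ?Z"
    using adj_closed_retraction_preimage[OF \<rho> X] p by (simp add: component_path_def)
  have "\<exists>i<length p. p ! i = x" if "x \<in> set p" for x using that by (simp add: in_set_conv_nth)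
  then obtain ix where ix: "\<And>x. x \<in> set p \<Longrightarrow> ix x < length p \<and> p ! ix x = x" by metis
  have "cyclic_map (winding_length p) (ix \<circ> \<rho>) ?Z" unfolding cyclic_map_def
  proof (intro ballI conjI allI impI)
    fix u assume u: "u \<in> ?Z"
    show "(ix \<circ> \<rho>) u < winding_length p"
      using u ix winding_length_bounds(2)[of p] order_less_le_trans by fastforce
    fix w assume uw: "adj u w"
    hence "w \<in> ?Z" using u adj_closedD[OF closed] by blast
    hence ix_image: "ix (\<rho> u) < length p" "ix (\<rho> w) < length p"
      "p ! ix (\<rho> u) = \<rho> u" "p ! ix (\<rho> w) = \<rho> w"
      using u ix by blast+
    have "\<rho> u = \<rho> w \<or> adj (\<rho> u) (\<rho> w)" using \<rho> uw by (simp add: retraction_def)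
    thus "cyclic_dist_le (winding_length p) 1 ((ix \<circ> \<rho>) u) ((ix \<circ> \<rho>) w)"
      using component_path_cyclic_dist_le[OF p ix_image(1,2)] ix_image(3,4) by auto
  qed
  moreover have "\<rho> u = u" if "u \<in> set p" for u
    using \<rho> p that by (auto simp: retraction_def component_path_def path_in_def)
  hence "inj_on (ix \<circ> \<rho>) (set p)" using ix by (intro inj_onI) (metis comp_apply)
  ultimately show ?thesis by blast
qed

lemma ex_core_component:
  assumes X: "finite X" "adj_closed X" "X \<noteq> {}"
    and E: "E \<subseteq> X" "separated 3 E" "\<And>e. e \<in> E \<Longrightarrow> dominated e"
    and deg: "\<And>v. v \<in> X - E \<Longrightarrow> card (nbs v - E) \<le> 2"
  obtains Z p where "Z \<subseteq> X" "Z \<noteq> {}" "adj_closed Z" "Z - E = set p" "component_path (X - E) p"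
    "almost_cyclic (winding_length p) Z"
proof -
  obtain \<rho> where \<rho>: "retraction X (X - E) \<rho>"
    using ex_retraction_if_dominated[OF X(2) E(1) separated_antimono[OF E(2)] E(3)] by auto
  have "nbs v \<inter> (X - E) = nbs v - E" if "v \<in> X - E" for v using that adj_closedD[OF X(2)] by auto
  moreover have "X - E \<noteq> {}" using X(3) \<rho> by (auto simp: retraction_def)
  ultimately obtain p where p: "component_path (X - E) p"
    using ex_component_path[of "X - E"] X(1) deg by (auto simp: max_degree_2_on_def)
  define Z where "Z = {u \<in> X. \<rho> u \<in> set p}"
  have "\<rho> u = u" if "u \<in> X - E" for u using \<rho> that unfolding retraction_def by blast
  moreover have "set p \<subseteq> X - E" using p by (simp add: component_path_def path_in_def)
  ultimately have core: "Z - E = set p" by (auto simp: Z_def subset_iff)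
  obtain \<phi> where "cyclic_map (winding_length p) \<phi> Z" "inj_on \<phi> (set p)"
    using ex_cyclic_map_retraction_preimage[OF \<rho> X(2) p] unfolding Z_def by blast
  hence cyclic: "almost_cyclic (winding_length p) Z"
    unfolding almost_cyclic_def using E(2) core by (intro exI[of _ E] exI[of _ \<phi>]) simp
  have closed: "adj_closed Z"
    unfolding Z_def using adj_closed_retraction_preimage[OF \<rho> X(2)] p
    by (simp add: component_path_def)
  have "set p \<noteq> {}" using p by (simp add: component_path_def)
  hence "Z \<noteq> {}" using core by auto
  moreover have "Z \<subseteq> X" by (auto simp: Z_def)
  ultimately show thesis using that[OF _ _ closed core p cyclic] by blast
qed

section \<open>Exceptional pieces\<close>

text \<open>Two triangles \<open>q b v\<close> and \<open>u c d\<close> joined by the edge \<open>v u\<close>.\<close>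

definition bow_at :: "'a \<Rightarrow> 'a set \<Rightarrow> bool" where
  "bow_at q Z \<longleftrightarrow> (\<exists>b v u c d. distinct [q, b, v, u, c, d] \<and> nbs q = {b, v} \<and> nbs b = {q, v} \<and>
     nbs v = {q, b, u} \<and> nbs u = {v, c, d} \<and> nbs c = {d, u} \<and> nbs d = {c, u} \<and>
     Z = {q, b, v, u, c, d})"

lemma bow_at_adj_closed: "bow_at q Z \<Longrightarrow> adj_closed Z"
  unfolding bow_at_def adj_closed_def by (elim exE conjE) simp

lemma bow_at_mem: "bow_at q Z \<Longrightarrow> q \<in> Z"
  unfolding bow_at_def by (elim exE conjE) simp

lemma bow_at_subset:
  assumes "bow_at q Z" "q \<in> X" "adj_closed X"
  shows "Z \<subseteq> X"
proof -
  obtain b v u c d where Z: "Z = {q, b, v, u, c, d}" and nbs: "nbs q = {b, v}" "nbs v = {q, b, u}"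
    "nbs u = {v, c, d}"
    using assms(1) unfolding bow_at_def by blast
  have "{b, v} \<subseteq> X" using assms(2,3) nbs(1) by (auto simp: adj_closed_def)
  moreover from this have "u \<in> X" using assms(3) nbs(2) by (auto simp: adj_closed_def)
  moreover from this have "{c, d} \<subseteq> X" using assms(3) nbs(3) by (auto simp: adj_closed_def)
  ultimately show ?thesis using Z assms(2) by blast
qed

lemma pack_colorable_on_bow:
  assumes "bow_at q Z"
  shows "pack_colorable_on [1, 1, 3, k] Z" "pack_colorable_on [1, 2, 2, 3] Z"
    "pack_colorable_on [2, 2, 2, 2, 3] Z" "pack_colorable_on [1, 2, 3, 4, 5, k] Z"
proof -
  obtain b v u c d where nbs: "distinct [q, b, v, u, c, d]" "nbs q = {b, v}" "nbs b = {q, v}"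
    "nbs v = {q, b, u}" "nbs u = {v, c, d}" "nbs c = {d, u}" "nbs d = {c, u}"
    and "Z = {q, b, v, u, c, d}"
    using assms unfolding bow_at_def by blast
  hence Z: "Z = set [q, b, v, u, c, d]" by simp
  note iffs = adj_iff_two[OF nbs(2)] adj_iff_two[OF nbs(3)] adj_iff_three[OF nbs(4)]
    adj_iff_three[OF nbs(5)] adj_iff_two[OF nbs(6)] adj_iff_two[OF nbs(7)]
  have far: "\<not> dist_le 2 q c" "\<not> dist_le 2 q d" "\<not> dist_le 2 b c" "\<not> dist_le 2 b d"
    "\<not> dist_le 1 v c" "\<not> dist_le 1 q u" "\<not> dist_le 1 q c"
    unfolding dist_le_1_iff dist_le_2_iff iffs using nbs(1) iffs by auto
  show "pack_colorable_on [1, 1, 3, k] Z" unfolding Z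
    using far by (intro pack_colorable_on_list[of "[1, 2, 0, 1, 0, 3]"]) simp_all
  show "pack_colorable_on [1, 2, 2, 3] Z" unfolding Z
    using far by (intro pack_colorable_on_list[of "[1, 2, 0, 3, 0, 1]"]) simp_all
  show "pack_colorable_on [2, 2, 2, 2, 3] Z" unfolding Z
    using far by (intro pack_colorable_on_list[of "[0, 1, 3, 2, 0, 1]"]) simp_all
  show "pack_colorable_on [1, 2, 3, 4, 5, k] Z" unfolding Z
    using far by (intro pack_colorable_on_list[of "[0, 1, 3, 2, 0, 1]"]) simp_all
qed

definition five_cycle :: "'a list \<Rightarrow> bool" where
  "five_cycle p \<longleftrightarrow> length p = 5 \<and> distinct p \<and>
     (\<forall>i<5. adj (p ! i) (p ! (Suc i mod 5)) \<and> \<not> adj (p ! i) (p ! ((i + 2) mod 5)))"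

lemma less_five_cases:
  fixes i :: nat
  shows "i < 5 \<Longrightarrow> i = 0 \<or> i = 1 \<or> i = 2 \<or> i = 3 \<or> i = 4"
  by linarith

lemma five_cycle_iff:
  "five_cycle [a, b, c, d, e] \<longleftrightarrow> distinct [a, b, c, d, e] \<and>
     adj a b \<and> adj b c \<and> adj c d \<and> adj d e \<and> adj e a \<and>
     \<not> adj a c \<and> \<not> adj b d \<and> \<not> adj c e \<and> \<not> adj d a \<and> \<not> adj e b"
proof -
  have less_five: "(\<forall>i<5. P i) \<longleftrightarrow> P 0 \<and> P 1 \<and> P 2 \<and> P 3 \<and> P 4" for P :: "nat \<Rightarrow> bool"
    by (simp add: eval_nat_numeral All_less_Suc conj_ac)
  show ?thesis unfolding five_cycle_def less_five by auto
qed

lemma five_cycleE: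
  assumes "five_cycle p"
  obtains a b c d e where "p = [a, b, c, d, e]"
proof -
  have "length p = 5" using assms by (simp add: five_cycle_def)
  thus ?thesis using that by (auto simp: length_Suc_conv numeral_eq_Suc)
qed

lemma five_cycle_rotate:
  "five_cycle [a, b, c, d, e] \<Longrightarrow> five_cycle [b, c, d, e, a]"
  by (simp add: five_cycle_iff) blast

lemma five_cycle_pair:
  assumes p: "five_cycle p" and xy: "x \<in> set p" "y \<in> set p" "x \<noteq> y"
  obtains a b c d e where "five_cycle [a, b, c, d, e]" "set p = {a, b, c, d, e}"
    "{x, y} = {a, b} \<or> {x, y} = {a, c}"
proof -
  obtain a b c d e where abcde: "p = [a, b, c, d, e]" using five_cycleE[OF p] .
  have rotations: "five_cycle [a, b, c, d, e]" "five_cycle [b, c, d, e, a]"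
    "five_cycle [c, d, e, a, b]" "five_cycle [d, e, a, b, c]" "five_cycle [e, a, b, c, d]"
    using p five_cycle_rotate unfolding abcde by metis+
  have sets: "set p = {a, b, c, d, e}" "set p = {b, c, d, e, a}" "set p = {c, d, e, a, b}"
    "set p = {d, e, a, b, c}" "set p = {e, a, b, c, d}" unfolding abcde by auto
  have "({x, y} = {a, b} \<or> {x, y} = {a, c}) \<or> ({x, y} = {b, c} \<or> {x, y} = {b, d}) \<or>
    ({x, y} = {c, d} \<or> {x, y} = {c, e}) \<or> ({x, y} = {d, e} \<or> {x, y} = {d, a}) \<or>
    ({x, y} = {e, a} \<or> {x, y} = {e, b})"
    using xy unfolding abcde list.set by (elim insertE emptyE) (auto simp: doubleton_eq_iff)
  thus thesis
    using that[OF rotations(1) sets(1)] that[OF rotations(2) sets(2)] that[OF rotations(3) sets(3)]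
      that[OF rotations(4) sets(4)] that[OF rotations(5) sets(5)] by (elim disjE) simp_all
qed

definition G1_on :: "'a set \<Rightarrow> bool" where
  "G1_on Z \<longleftrightarrow> (\<exists>a b c d e f. five_cycle [a, b, c, d, e] \<and> f \<notin> {a, b, c, d, e} \<and> nbs f = {a, c} \<and>
     Z = {a, b, c, d, e, f})"

definition pentagon_piece :: "'a set \<Rightarrow> bool" where
  "pentagon_piece Z \<longleftrightarrow> (\<exists>a b c d e. five_cycle [a, b, c, d, e] \<and> (Z = {a, b, c, d, e} \<or>
     (\<exists>f. f \<notin> {a, b, c, d, e} \<and> (nbs f = {a, b} \<or> nbs f = {a, c}) \<and> Z = {a, b, c, d, e, f})))"

lemma pack_colorable_on_pentagon:
  assumes "five_cycle [a, b, c, d, e]"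
  shows "pack_colorable_on [1, 2, 2, 3] {a, b, c, d, e}"
    "pack_colorable_on [2, 2, 2, 2, 3] {a, b, c, d, e}"
proof -
  have "\<not> dist_le 1 a c" using assms by (auto simp: five_cycle_iff)
  hence "pack_colorable_on [1, 2, 2, 3] (set [a, b, c, d, e])"
    by (intro pack_colorable_on_list[of "[0, 1, 0, 2, 3]"]) simp_all
  moreover have "pack_colorable_on [2, 2, 2, 2, 3] (set [a, b, c, d, e])"
    by (intro pack_colorable_on_list[of "[0, 1, 2, 3, 4]"]) simp_all
  ultimately show "pack_colorable_on [1, 2, 2, 3] {a, b, c, d, e}"
    "pack_colorable_on [2, 2, 2, 2, 3] {a, b, c, d, e}" by simp_all
qed

lemma pack_colorable_on_pentagon_edge:
  assumes p: "five_cycle [a, b, c, d, e]" and f: "f \<notin> {a, b, c, d, e}" "nbs f = {a, b}"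
  shows "pack_colorable_on [1, 2, 2, 3] {a, b, c, d, e, f}"
    "pack_colorable_on [2, 2, 2, 2, 3] {a, b, c, d, e, f}"
proof -
  have f_iff: "adj x f \<longleftrightarrow> x = a \<or> x = b" for x using adj_iff_two[OF f(2)] adj_commute by metis
  have far: "\<not> dist_le 1 c f" "\<not> dist_le 1 e f" "\<not> dist_le 1 c e" "\<not> dist_le 2 d f"
    unfolding dist_le_1_iff dist_le_2_iff f_iff using p f(1) adj_commute
    by (auto simp: five_cycle_iff)
  have "pack_colorable_on [1, 2, 2, 3] (set [a, b, c, d, e, f])"
    using far by (intro pack_colorable_on_list[of "[1, 2, 0, 3, 0, 0]"]) simp_all
  moreover have "pack_colorable_on [2, 2, 2, 2, 3] (set [a, b, c, d, e, f])"
    using far by (intro pack_colorable_on_list[of "[1, 2, 3, 0, 4, 0]"]) simp_all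
  ultimately show "pack_colorable_on [1, 2, 2, 3] {a, b, c, d, e, f}"
    "pack_colorable_on [2, 2, 2, 2, 3] {a, b, c, d, e, f}" by simp_all
qed

lemma pack_colorable_on_pentagon_twin:
  assumes p: "five_cycle [a, b, c, d, e]" and f: "f \<notin> {a, b, c, d, e}" "nbs f = {a, c}"
  shows "pack_colorable_on [1, 2, 2, 3] {a, b, c, d, e, f}"
proof -
  have f_iff: "adj x f \<longleftrightarrow> x = a \<or> x = c" for x using adj_iff_two[OF f(2)] adj_commute by metis
  have "\<not> dist_le 1 b f" "\<not> dist_le 1 d f" "\<not> dist_le 1 b d"
    unfolding dist_le_1_iff f_iff using p f(1) by (auto simp: five_cycle_iff)
  hence "pack_colorable_on [1, 2, 2, 3] (set [a, b, c, d, e, f])"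
    by (intro pack_colorable_on_list[of "[1, 0, 2, 0, 3, 0]"]) simp_all
  thus ?thesis by simp
qed

lemma pack_colorable_on_pentagon_piece:
  assumes "pentagon_piece Z"
  shows "pack_colorable_on [1, 2, 2, 3] Z" "pack_colorable_on [2, 2, 2, 2, 3] Z \<or> G1_on Z"
  using assms pack_colorable_on_pentagon pack_colorable_on_pentagon_edge
    pack_colorable_on_pentagon_twin
  unfolding pentagon_piece_def G1_on_def by metis+

definition piece :: "'a set \<Rightarrow> bool" where
  "piece Z \<longleftrightarrow> (\<exists>q. bow_at q Z) \<or> (\<exists>N\<ge>3. almost_cyclic N Z \<and> (N = 5 \<longrightarrow> pentagon_piece Z))"

lemma pack_colorable_on_piece:
  assumes "adj_closed Z" "piece Z"
  shows "pack_colorable_on [1, 1, 3, k] Z" "pack_colorable_on [1, 2, 2, 3] Z"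
    "pack_colorable_on [2, 2, 2, 2, 3] Z \<or> G1_on Z" "pack_colorable_on [1, 2, 3, 4, 5, k] Z"
proof -
  have "pack_colorable_on [1, 1, 3, k] Z \<and> pack_colorable_on [1, 2, 2, 3] Z \<and>
    (pack_colorable_on [2, 2, 2, 2, 3] Z \<or> G1_on Z) \<and> pack_colorable_on [1, 2, 3, 4, 5, k] Z"
  proof (cases "\<exists>q. bow_at q Z")
    case True
    thus ?thesis using pack_colorable_on_bow by blast
  next
    case False
    then obtain N where N: "3 \<le> N" "almost_cyclic N Z" "N = 5 \<Longrightarrow> pentagon_piece Z"
      using assms(2) unfolding piece_def by blast
    note cyclic = pack_colorable_on_if_almost_cyclic[OF assms(1) N(2)]
    have "pack_colorable_on [1, 1, 3, k] Z"
      using cyclic[of _ "[1, 1, 3, k]" 2] ex_cyclic_coloring_113k[of N k] by auto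
    moreover have "pack_colorable_on [1, 2, 3, 4, 5, k] Z"
      using cyclic[of _ "[1, 2, 3, 4, 5, k]" 2] ex_cyclic_coloring_12345k[of N k] by auto
    moreover have "pack_colorable_on [1, 2, 2, 3] Z"
      using cyclic[of _ "[1, 2, 2, 3]" 3] ex_cyclic_coloring_1223[OF N(1)]
        pack_colorable_on_pentagon_piece(1) N(3) by (cases "N = 5") auto
    moreover have "pack_colorable_on [2, 2, 2, 2, 3] Z \<or> G1_on Z"
      using cyclic[of _ "[2, 2, 2, 2, 3]" 4] ex_cyclic_coloring_22223[OF N(1)]
        pack_colorable_on_pentagon_piece(2) N(3) by (cases "N = 5") auto
    ultimately show ?thesis by blast
  qed
  thus "pack_colorable_on [1, 1, 3, k] Z" "pack_colorable_on [1, 2, 2, 3] Z"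
    "pack_colorable_on [2, 2, 2, 2, 3] Z \<or> G1_on Z" "pack_colorable_on [1, 2, 3, 4, 5, k] Z"
    by simp_all
qed

lemma five_cycle_if_component_path:
  assumes p: "component_path C p" and "winding_length p = 5"
  shows "five_cycle p"
proof -
  have len: "length p = 5" and last: "adj (last p) (hd p)"
    using assms(2) by (auto simp: winding_length_def closes_up_def split: if_splits)
  have "adj (p ! i) (p ! (Suc i mod 5))" if "i < 5" for i
  proof (cases "i = 4")
    case True
    moreover have "p \<noteq> []" using len by auto
    ultimately show ?thesis using last len by (simp add: last_conv_nth hd_conv_nth)
  next
    case False
    thus ?thesis
      using p successively_nth[of adj p i] that len by (simp add: component_path_def path_in_def)
  qed
  moreover have "\<not> adj (p ! i) (p ! ((i + 2) mod 5))" if "i < 5" for i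
  proof -
    define j where "j = (i + 2) mod 5"
    have "j \<noteq> Suc i mod 5" "i \<noteq> Suc j mod 5" "j < 5"
      using less_five_cases[OF that] unfolding j_def by (elim disjE; simp)+
    moreover have "adj (p ! i) (p ! j) \<longrightarrow> j = Suc i mod 5 \<or> i = Suc j mod 5" if "j < 5"
      using p that \<open>i < 5\<close> len by (simp add: component_path_def)
    ultimately show ?thesis unfolding j_def[symmetric] by blast
  qed
  ultimately show ?thesis using p len by (simp add: five_cycle_def component_path_def path_in_def)
qed

lemma five_cycle_ears_dist_le:
  assumes p: "five_cycle [a, b, c, d, e]" and f: "nbs f = {a, b} \<or> nbs f = {a, c}"
    and g: "card (nbs g) = 2" "nbs g \<subseteq> {a, b, c, d, e}"
  shows "dist_le 3 f g"
proof -
  have "\<not> nbs g \<subseteq> {d}" using g(1) card_mono[of "{d}" "nbs g"] by auto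
  then obtain w where "adj g w" "w \<in> {a, b, c, e}" using g(2) in_nbs by blast
  hence w: "adj w g" "w \<in> {a, b, c, e}" using adj_sym by blast+
  have fab: "adj f a" "adj f b \<or> adj f c" using f in_nbs by blast+
  have "adj a e" "adj a b" "adj b c" using p adj_sym by (auto simp: five_cycle_iff)
  moreover from this have "adj c b" using adj_sym by blast
  ultimately show ?thesis unfolding dist_le_3_iff using w fab by blast
qed

lemma pentagon_piece_if_five_cycle:
  assumes Z: "adj_closed Z" "Z - E = set p" and p: "five_cycle p"
    and E: "separated 3 E" "\<And>f. f \<in> E \<Longrightarrow> card (nbs f) = 2"
  shows "pentagon_piece Z"
proof (cases "Z \<inter> E = {}")
  case True
  hence "Z = set p" using Z(2) by blast
  moreover obtain a b c d e where "p = [a, b, c, d, e]" using five_cycleE[OF p] .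
  ultimately have "five_cycle [a, b, c, d, e]" "Z = {a, b, c, d, e}" using p by simp_all
  thus ?thesis unfolding pentagon_piece_def by blast
next
  case False
  then obtain f where f: "f \<in> Z" "f \<in> E" by blast
  have nbs_ear: "nbs g \<subseteq> set p" if g: "g \<in> Z" "g \<in> E" for g
  proof
    fix w assume "w \<in> nbs g"
    hence gw: "adj g w" by simp
    hence "w \<notin> E" using separatedD[OF E(1) g(2), of w] adj_irrefl dist_le_3_iff by metis
    thus "w \<in> set p" using adj_closedD[OF Z(1) g(1) gw] Z(2) by blast
  qed
  obtain x y where xy: "nbs f = {x, y}" "x \<noteq> y" using E(2)[OF f(2)] by (meson card_2_iff)
  hence "x \<in> set p" "y \<in> set p" using nbs_ear[OF f] by blast+
  then obtain a b c d e where cycle: "five_cycle [a, b, c, d, e]" "set p = {a, b, c, d, e}"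
    "{x, y} = {a, b} \<or> {x, y} = {a, c}"
    using five_cycle_pair[OF p _ _ xy(2)] by blast
  have nbs_f: "nbs f = {a, b} \<or> nbs f = {a, c}" using cycle(3) xy(1) by simp
  have "g = f" if g: "g \<in> Z" "g \<in> E" for g
  proof -
    have "nbs g \<subseteq> {a, b, c, d, e}" using nbs_ear[OF g] cycle(2) by simp
    hence "dist_le 3 f g" by (rule five_cycle_ears_dist_le[OF cycle(1) nbs_f E(2)[OF g(2)]])
    thus ?thesis using separatedD[OF E(1) f(2) g(2)] by blast
  qed
  hence "Z = insert f (set p)" using f Z(2) by blast
  hence "Z = {a, b, c, d, e, f}" unfolding cycle(2) by auto
  moreover have "f \<notin> {a, b, c, d, e}" using f(2) Z(2) cycle(2) by blast
  ultimately show ?thesis unfolding pentagon_piece_def using cycle(1) nbs_f by blast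
qed

end

section \<open>Choice of the deleted vertices\<close>

locale subcubic_adjacency = simple_adjacency +
  assumes finite_nbs [simp]: "finite (nbs u)"
    and card_nbs: "card (nbs u) \<le> 3"
begin

lemma nbs_eq_three:
  assumes "adj u x" "adj u y" "adj u z" "x \<noteq> y" "x \<noteq> z" "y \<noteq> z"
  shows "nbs u = {x, y, z}"
proof -
  have "{x, y, z} \<subseteq> nbs u" "card {x, y, z} = 3" using assms by simp_all
  thus ?thesis using card_nbs[of u] by (metis card_seteq finite_nbs)
qed

lemma card_nbs_three:
  assumes "adj u x" "adj u y" "adj u z" "x \<noteq> y" "x \<noteq> z" "y \<noteq> z"
  shows "card (nbs u) = 3"
  using nbs_eq_three[OF assms] assms by simp

lemma nbs_eq_two:
  assumes "adj u x" "adj u y" "x \<noteq> y" "card (nbs u) \<noteq> 3"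
  shows "nbs u = {x, y}"
  using assms card_nbs_three[of u x y] by (auto simp: nbs_def)

lemma card_nbs_eq_if_twins:
  assumes "twins u w"
  shows "card (nbs u) = card (nbs w)"
proof (cases "adj u w")
  case True
  hence "card (nbs u) = Suc (card (nbs u - {w}))" "card (nbs w) = Suc (card (nbs w - {u}))"
    using adj_sym by (simp_all only: in_nbs finite_nbs card.remove)
  thus ?thesis using assms by (simp only: twins_def)
next
  case False
  hence "\<not> adj w u" using adj_sym by blast
  thus ?thesis using False assms by (simp add: twins_def)
qed

definition fold_transversal :: "'a set \<Rightarrow> bool" where
  "fold_transversal Q \<longleftrightarrow> (\<forall>q\<in>Q. card (nbs q) = 2 \<and> dominated q) \<and>
     (\<forall>v. card (nbs v) = 3 \<longrightarrow> (\<exists>q\<in>Q. adj v q)) \<and>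
     (\<forall>q\<in>Q. \<forall>e\<in>Q. q \<noteq> e \<longrightarrow> dist_le 3 q e \<longrightarrow> twins q e \<or> (\<exists>Z. bow_at q Z))"

text \<open>
  In case (a), a vertex with a twin is deleted. Domination alone is not enough: the vertex opposite
  the only 3-vertex of a 4-cycle is dominated, but its choice could keep both neighbours of that
  3-vertex from being deleted.
\<close>

definition twin_fold_set :: "'a set" where
  "twin_fold_set = {q. card (nbs q) = 2 \<and> (\<exists>v. adj q v \<and> card (nbs v) = 3) \<and>
     (\<exists>r. r \<noteq> q \<and> twins q r)}"

lemma twin_fold_setE:
  assumes "q \<in> twin_fold_set" "adj q v" "card (nbs v) = 3"
  obtains r where "r \<noteq> q" "twins q r" "adj r v"
proof -
  obtain r where r: "r \<noteq> q" "twins q r" using assms(1) by (auto simp: twin_fold_set_def)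
  have "card (nbs q) = 2" using assms(1) by (simp add: twin_fold_set_def)
  hence "v \<noteq> r" using card_nbs_eq_if_twins[OF r(2)] assms(3) by auto
  hence "adj r v" using twins_adj[OF r(2) assms(2)] by blast
  thus thesis using that r by blast
qed

lemma twin_fold_set_twins_if_common_nb:
  assumes q: "q \<in> twin_fold_set" "adj q v" and e: "e \<in> twin_fold_set" "adj e v"
    and v: "card (nbs v) = 3" and "q \<noteq> e"
  shows "twins q e"
proof -
  obtain r where r: "r \<noteq> q" "twins q r" "adj r v" using twin_fold_setE[OF q v] .
  obtain s where s: "s \<noteq> e" "twins e s" "adj s v" using twin_fold_setE[OF e v] .
  have "r = e \<or> r = s \<or> q = s"
  proof (rule ccontr)
    assume "\<not> ?thesis"
    hence "nbs v = {q, r, e}" "s \<notin> {q, r, e}"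
      using nbs_eq_three[of v q r e] q(2) r e(2) s(1) \<open>q \<noteq> e\<close> adj_sym by auto
    thus False using s(3) adj_sym in_nbs by metis
  qed
  thus ?thesis using r(2) s(2) twins_sym twins_trans by metis
qed

definition cubic_independent :: bool where
  "cubic_independent \<longleftrightarrow> (\<forall>v w. adj v w \<longrightarrow> card (nbs v) = 3 \<longrightarrow> card (nbs w) \<noteq> 3)"

lemma cubic_independentD:
  "cubic_independent \<Longrightarrow> adj v w \<Longrightarrow> card (nbs v) = 3 \<Longrightarrow> card (nbs w) \<noteq> 3"
  unfolding cubic_independent_def by blast

lemma in_twin_fold_set_if_short_cycle:
  assumes indep: cubic_independent and v: "card (nbs v) = 3"
    and xy: "adj v x" "adj v y" "x \<noteq> y" "adj x y \<or> (\<exists>w. w \<noteq> v \<and> adj w x \<and> adj w y)"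
  shows "x \<in> twin_fold_set"
proof -
  have x: "card (nbs x) \<noteq> 3" "adj x v" and y: "card (nbs y) \<noteq> 3" "adj y v"
    using cubic_independentD[OF indep] v xy(1,2) adj_sym by blast+
  have neq: "v \<noteq> x" "v \<noteq> y" using xy adj_irrefl by blast+
  from xy(4) have "\<exists>z. z \<noteq> v \<and> nbs x = {v, z} \<and> twins x y"
  proof
    assume "adj x y"
    hence "nbs x = {v, y}" "nbs y = {v, x}" using nbs_eq_two x y neq adj_sym by metis+
    thus ?thesis using neq by (auto simp: twins_def)
  next
    assume "\<exists>w. w \<noteq> v \<and> adj w x \<and> adj w y"
    then obtain w where w: "w \<noteq> v" "adj w x" "adj w y" by blast
    hence "nbs x = {v, w}" "nbs y = {v, w}" using nbs_eq_two x y adj_sym by metis+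
    thus ?thesis using w adj_irrefl xy(1,2) by (auto simp: twins_def)
  qed
  then obtain z where "z \<noteq> v" "nbs x = {v, z}" "twins x y" by blast
  moreover from this have "card (nbs x) = 2" by simp
  ultimately show ?thesis unfolding twin_fold_set_def mem_Collect_eq using x(2) v xy(3) by metis
qed

text \<open>
  If the neighbour \<open>x\<close> of \<open>q\<close> has degree less than 3, then \<open>q\<close>, its twin and \<open>x\<close> have no neighbour
  other than \<open>v\<close> outside the set they form.
\<close>

lemma twin_fold_set_adj_if_path:
  assumes indep: cubic_independent
    and q: "q \<in> twin_fold_set" "adj q v" "card (nbs v) = 3" and e: "e \<in> twin_fold_set" "q \<noteq> e"
    and p: "adj q x" "card (nbs x) \<noteq> 3" "x = y \<or> adj x y" "adj y e"
  shows "adj v e"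
proof -
  obtain r where r: "r \<noteq> q" "twins q r" "adj r v" using twin_fold_setE[OF q] .
  have x_neq_v: "x \<noteq> v" using p(2) q(3) by blast
  have nbs_q: "nbs q = {v, x}"
    using nbs_eq_two[of q v x] q p(1) x_neq_v by (auto simp: twin_fold_set_def)
  have card_e: "card (nbs e) = 2" using e(1) by (simp add: twin_fold_set_def)
  obtain u where u: "adj e u" "card (nbs u) = 3" using e(1) by (auto simp: twin_fold_set_def)
  have card_r: "card (nbs r) \<noteq> 3"
    using cubic_independentD[OF indep] r(3) q(3) adj_sym by blast
  show ?thesis
  proof (cases "r = x")
    case True
    have nbs_r: "nbs r = {v, q}"
      using nbs_eq_two[of r v q] r(3) card_r True p(1) q adj_sym adj_irrefl by metis
    have "y = v \<or> y = q \<or> y = r" using p(3) True nbs_r adj_iff_two by metis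
    hence "adj v e \<or> e = v \<or> e = q \<or> e = r" using p(4) nbs_q nbs_r True adj_iff_two by metis
    thus ?thesis using e(2) card_e q(3) r(3) adj_sym by auto
  next
    case False
    have adj_rx: "adj r x" using twins_adj[OF r(2) p(1)] False by blast
    have nbs_r: "nbs r = {v, x}" using nbs_eq_two[of r v x] r(3) adj_rx card_r x_neq_v by auto
    have nbs_x: "nbs x = {q, r}" using nbs_eq_two[of x q r] p(1,2) adj_rx r(1) adj_sym by metis
    have "card (nbs q) \<noteq> 3" using q(1) by (auto simp: twin_fold_set_def)
    hence "e \<noteq> x" using u nbs_x card_r adj_iff_two by metis
    moreover have "e \<noteq> v" using card_e q(3) by auto
    moreover have "y = q \<or> y = r \<or> y = x" using p(3) nbs_x adj_iff_two by metis
    hence "e = v \<or> e = x \<or> e = q \<or> e = r" using p(4) nbs_q nbs_r nbs_x adj_iff_two by metis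
    ultimately show ?thesis using e(2) r(3) adj_sym by blast
  qed
qed

lemma twin_fold_set_twins_if_dist_le:
  assumes indep: cubic_independent
    and q: "q \<in> twin_fold_set" and e: "e \<in> twin_fold_set" and "q \<noteq> e" "dist_le 3 q e"
  shows "twins q e"
proof -
  obtain v where v: "adj q v" "card (nbs v) = 3" using q by (auto simp: twin_fold_set_def)
  obtain u where u: "adj e u" "card (nbs u) = 3" using e by (auto simp: twin_fold_set_def)
  obtain x y where p: "adj q x" "x = y \<or> adj x y" "adj y e"
    using assms(4,5) u(1) adj_sym unfolding dist_le_3_iff by metis
  consider "card (nbs x) \<noteq> 3" | "card (nbs y) \<noteq> 3" | "x = y" "card (nbs x) = 3"
    using p(2) cubic_independentD[OF indep] by blast
  then obtain t where "adj q t" "adj e t" "card (nbs t) = 3"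
  proof cases
    case 1
    hence "adj v e" using twin_fold_set_adj_if_path[OF indep q v e assms(4)] p by blast
    thus ?thesis using that v adj_sym by blast
  next
    case 2
    hence "adj u q"
      using twin_fold_set_adj_if_path[OF indep e u q, of y x] assms(4) p adj_sym by blast
    thus ?thesis using that u adj_sym by blast
  next
    case 3
    thus ?thesis using that p adj_sym by blast
  qed
  thus ?thesis using twin_fold_set_twins_if_common_nb q e assms(4) by blast
qed

lemma fold_transversal_twin_fold_set:
  assumes indep: cubic_independent
    and short_cycle: "\<And>v. card (nbs v) = 3 \<Longrightarrow> \<exists>x y. adj v x \<and> adj v y \<and> x \<noteq> y \<and>
      (adj x y \<or> (\<exists>w. w \<noteq> v \<and> adj w x \<and> adj w y))"
  shows "fold_transversal twin_fold_set"
  unfolding fold_transversal_def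
proof (intro conjI ballI allI impI)
  fix q assume q: "q \<in> twin_fold_set"
  thus "card (nbs q) = 2" by (simp add: twin_fold_set_def)
  thus "dominated q" using q dominated_if_twins by (fastforce simp: twin_fold_set_def)
next
  fix v assume "card (nbs v) = 3"
  thus "\<exists>q\<in>twin_fold_set. adj v q"
    using short_cycle in_twin_fold_set_if_short_cycle[OF indep] by meson
qed (use twin_fold_set_twins_if_dist_le[OF indep] in blast)

text \<open>
  In case (b), the dominating vertex must be a neighbour: for a 4-cycle with one edge \<open>vr\<close> completed
  to a triangle, deleting a further neighbour of \<open>v\<close> on the 4-cycle would leave \<open>r\<close> of degree 3.
\<close>

definition triangle_fold_set :: "'a set" where
  "triangle_fold_set = {q. \<exists>v z. card (nbs v) = 3 \<and> v \<noteq> z \<and> nbs q = {v, z} \<and> adj v z}"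

lemma triangle_fold_setE:
  assumes "q \<in> triangle_fold_set" "adj q x"
  obtains y where "y \<noteq> x" "nbs q = {x, y}" "adj x y"
proof -
  obtain v z where "v \<noteq> z" "nbs q = {v, z}" "adj v z"
    using assms(1) by (auto simp: triangle_fold_set_def)
  thus ?thesis using that[of v] that[of z] assms(2) adj_sym adj_iff_two by (metis insert_commute)
qed

lemma triangle_fold_set_twins_if_adj_or_common_nb:
  assumes q: "q \<in> triangle_fold_set" and e: "e \<in> triangle_fold_set" and "q \<noteq> e"
    and t: "adj q e \<or> (adj q t \<and> adj e t)"
  shows "twins q e"
proof (cases "adj q e")
  case True
  obtain y where y: "y \<noteq> e" "nbs q = {e, y}" "adj e y" using triangle_fold_setE[OF q True] .
  obtain x where "x \<noteq> q" "nbs e = {q, x}" using triangle_fold_setE[OF e adj_sym[OF True]] .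
  moreover from this have "x = y" using y adj_iff_two adj_sym True adj_irrefl by metis
  ultimately show ?thesis using y by (auto simp: twins_def)
next
  case False
  hence t: "adj q t" "adj e t" using t by auto
  obtain y where y: "y \<noteq> t" "nbs q = {t, y}" "adj t y" using triangle_fold_setE[OF q t(1)] .
  obtain x where x: "x \<noteq> t" "nbs e = {t, x}" "adj t x" using triangle_fold_setE[OF e t(2)] .
  have "y \<noteq> e" "x \<noteq> q" "y \<noteq> q" "x \<noteq> e"
    using False adj_sym adj_irrefl adj_iff_two[OF y(2)] adj_iff_two[OF x(2)] by metis+
  hence "x = y"
    using nbs_eq_three[of t q e y] t x(3) y(3) adj_sym assms(3) adj_iff_three by metis
  hence "nbs q = nbs e" using y(2) x(2) by simp
  moreover have "\<not> adj e q" using False adj_sym by blast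
  ultimately show ?thesis using False by (simp add: twins_def adj_irrefl)
qed

definition cubic_matching :: bool where
  "cubic_matching \<longleftrightarrow> (\<forall>v x y. card (nbs v) = 3 \<longrightarrow> adj v x \<longrightarrow> adj v y \<longrightarrow>
     card (nbs x) = 3 \<longrightarrow> card (nbs y) = 3 \<longrightarrow> x = y)"

lemma cubic_matchingD:
  "cubic_matching \<Longrightarrow> card (nbs v) = 3 \<Longrightarrow> adj v x \<Longrightarrow> adj v y \<Longrightarrow> card (nbs x) = 3 \<Longrightarrow>
    card (nbs y) = 3 \<Longrightarrow> x = y"
  unfolding cubic_matching_def by blast

lemma ex_adj_triangle_fold_set:
  assumes matching: cubic_matching and v: "card (nbs v) = 3" "adj v x" "adj v y" "adj x y"
  shows "\<exists>q\<in>triangle_fold_set. adj v q"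
proof -
  have fold: "x \<in> triangle_fold_set" if "card (nbs x) \<noteq> 3" "adj v x" "adj v y" "adj x y" for x y
  proof -
    have "adj x v" "v \<noteq> y" using that adj_sym adj_irrefl by metis+
    hence "nbs x = {v, y}" using nbs_eq_two that by metis
    thus ?thesis unfolding triangle_fold_set_def mem_Collect_eq using v that \<open>v \<noteq> y\<close> by metis
  qed
  have "card (nbs x) \<noteq> 3 \<or> card (nbs y) \<noteq> 3"
    using cubic_matchingD[OF matching] v adj_irrefl by metis
  thus ?thesis using fold[of x y] fold[of y x] v adj_sym by metis
qed

lemma bow_at_if_joined_triangles:
  assumes matching: cubic_matching
    and q: "q \<in> triangle_fold_set" "adj q v" and e: "e \<in> triangle_fold_set" "adj e u"
    and vu: "adj v u" and distinct: "\<not> twins q e" "q \<noteq> e"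
  shows "\<exists>Z. bow_at q Z"
proof -
  obtain b where b: "b \<noteq> v" "nbs q = {v, b}" "adj v b" using triangle_fold_setE[OF q] .
  obtain d where d: "d \<noteq> u" "nbs e = {u, d}" "adj u d" using triangle_fold_setE[OF e] .
  have apart: "\<not> adj q e" "\<not> (adj q t \<and> adj e t)" for t
    using triangle_fold_set_twins_if_adj_or_common_nb[OF q(1) e(1) distinct(2)] distinct(1)
    by blast+
  have neq_near: "q \<noteq> b" "q \<noteq> v" "e \<noteq> d" "e \<noteq> u" "v \<noteq> u"
    using adj_iff_two[OF b(2)] adj_iff_two[OF d(2)] adj_irrefl vu by metis+
  have neq_far: "q \<noteq> u" "q \<noteq> d" "b \<noteq> u" "b \<noteq> d" "b \<noteq> e" "v \<noteq> d" "v \<noteq> e"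
    using apart adj_iff_two[OF b(2)] adj_iff_two[OF d(2)] adj_sym by metis+
  have nbs_v: "nbs v = {q, b, u}"
    using nbs_eq_three[of v q b u] q(2) b vu neq_near neq_far adj_sym by metis
  have nbs_u: "nbs u = {v, e, d}"
    using nbs_eq_three[of u v e d] e(2) d vu neq_near neq_far adj_sym by metis
  have card_v: "card (nbs v) = 3" and card_u: "card (nbs u) = 3"
    using nbs_v nbs_u neq_near neq_far by auto
  have "card (nbs b) \<noteq> 3"
    using cubic_matchingD[OF matching card_v b(3) vu _ card_u] neq_far by blast
  hence nbs_b: "nbs b = {q, v}"
    using nbs_eq_two[of b q v] adj_iff_two[OF b(2)] b(3) neq_near adj_sym by metis
  have "card (nbs d) \<noteq> 3"
    using cubic_matchingD[OF matching card_u d(3) adj_sym[OF vu] _ card_v] neq_far by blast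
  hence nbs_d: "nbs d = {e, u}"
    using nbs_eq_two[of d e u] adj_iff_two[OF d(2)] d(3) neq_near adj_sym by metis
  have nbs_q: "nbs q = {b, v}" and nbs_e: "nbs e = {d, u}" using b(2) d(2) by auto
  have "distinct [q, b, v, u, e, d]" using neq_near neq_far b(1) d(1) distinct(2) by auto
  hence "bow_at q {q, b, v, u, e, d}"
    unfolding bow_at_def using nbs_q nbs_b nbs_v nbs_u nbs_e nbs_d
    by (intro exI[of _ b] exI[of _ v] exI[of _ u] exI[of _ e] exI[of _ d] conjI refl)
  thus ?thesis by blast
qed

lemma fold_transversal_triangle_fold_set:
  assumes matching: cubic_matching
    and triangle: "\<And>v. card (nbs v) = 3 \<Longrightarrow> \<exists>x y. adj v x \<and> adj v y \<and> adj x y"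
  shows "fold_transversal triangle_fold_set"
  unfolding fold_transversal_def
proof (intro conjI ballI allI impI)
  fix q assume "q \<in> triangle_fold_set"
  then obtain v z where q: "v \<noteq> z" "nbs q = {v, z}" "adj v z" by (auto simp: triangle_fold_set_def)
  thus "card (nbs q) = 2" by simp
  have "v \<noteq> q" using q(2) adj_iff_two adj_irrefl by metis
  thus "dominated q" unfolding dominated_def using q by (auto intro!: exI[of _ v])
next
  fix v assume "card (nbs v) = 3"
  thus "\<exists>q\<in>triangle_fold_set. adj v q" using triangle ex_adj_triangle_fold_set[OF matching] by meson
next
  fix q e assume qe: "q \<in> triangle_fold_set" "e \<in> triangle_fold_set" "q \<noteq> e" "dist_le 3 q e"
  then consider "adj q e" | x where "adj q x" "adj e x" | x y where "adj q x" "adj x y" "adj e y"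
    unfolding dist_le_3_iff using adj_sym by blast
  thus "twins q e \<or> (\<exists>Z. bow_at q Z)"
    using triangle_fold_set_twins_if_adj_or_common_nb[OF qe(1-3)]
      bow_at_if_joined_triangles[OF matching qe(1) _ qe(2)] qe(3)
    by cases blast+
qed

section \<open>Decomposition into pieces\<close>

lemma card_nbs_Diff_fold_transversal:
  assumes Q: "fold_transversal Q" and no_bow: "\<And>q Z. q \<in> X \<Longrightarrow> \<not> bow_at q Z"
    and X: "adj_closed X" "v \<in> X"
    and E: "E \<subseteq> Q \<inter> X" "\<And>q. q \<in> Q \<inter> X \<Longrightarrow> \<exists>e\<in>E. dist_le 3 q e"
  shows "card (nbs v - E) \<le> 2"
proof (cases "card (nbs v) = 3")
  case True
  then obtain q where q: "q \<in> Q" "adj v q" using Q unfolding fold_transversal_def by blast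
  hence "q \<in> X" using X adj_closedD by blast
  then obtain e where e: "e \<in> E" "dist_le 3 q e" using E(2) q(1) by blast
  have "e \<in> Q" using e(1) E(1) by blast
  hence "q = e \<or> twins q e"
    using Q q(1) e(2) no_bow[OF \<open>q \<in> X\<close>] unfolding fold_transversal_def by blast
  moreover have "card (nbs e) = 2" using Q \<open>e \<in> Q\<close> unfolding fold_transversal_def by blast
  hence "v \<noteq> e" using True by auto
  ultimately have "adj v e" using q(2) adj_sym twins_adj by metis
  hence "e \<in> nbs v" by simp
  hence "nbs v - E \<subset> nbs v" using e(1) by blast
  hence "card (nbs v - E) < card (nbs v)" by (rule psubset_card_mono[OF finite_nbs])
  thus ?thesis using True by simp
next
  case False
  have "card (nbs v - E) \<le> card (nbs v)" by (intro card_mono) auto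
  thus ?thesis using False card_nbs[of v] by linarith
qed

lemma ex_piece:
  assumes Q: "fold_transversal Q" and X: "finite X" "adj_closed X" "X \<noteq> {}"
  shows "\<exists>Z\<subseteq>X. Z \<noteq> {} \<and> adj_closed Z \<and> piece Z"
proof (cases "\<exists>q\<in>X. \<exists>Z. bow_at q Z")
  case True
  then obtain q Z where q: "q \<in> X" and bow: "bow_at q Z" by blast
  have "Z \<subseteq> X" using bow_at_subset[OF bow q X(2)] .
  moreover have "Z \<noteq> {}" using bow_at_mem[OF bow] by blast
  moreover have "piece Z" using bow unfolding piece_def by blast
  ultimately show ?thesis using bow_at_adj_closed[OF bow] by blast
next
  case False
  obtain E where E: "E \<subseteq> Q \<inter> X" "separated 3 E" "\<And>q. q \<in> Q \<inter> X \<Longrightarrow> \<exists>e\<in>E. dist_le 3 q e"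
    using ex_maximal_separated_subset[of "Q \<inter> X" 3] X(1) by blast
  have deg: "card (nbs v - E) \<le> 2" if "v \<in> X - E" for v
    using card_nbs_Diff_fold_transversal[OF Q _ X(2) _ E(1,3)] False that by blast
  have fold: "dominated e" "card (nbs e) = 2" if "e \<in> E" for e
    using that Q E(1) unfolding fold_transversal_def by blast+
  have "E \<subseteq> X" using E(1) by blast
  from ex_core_component[OF X this E(2) fold(1) deg]
  obtain Z p where Z: "Z \<subseteq> X" "Z \<noteq> {}" "adj_closed Z" "Z - E = set p"
    "component_path (X - E) p" "almost_cyclic (winding_length p) Z" .
  have "pentagon_piece Z" if "winding_length p = 5"
    using pentagon_piece_if_five_cycle[OF Z(3,4) _ E(2)] five_cycle_if_component_path[OF Z(5) that]
      fold(2) by blast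
  hence "piece Z" unfolding piece_def using Z(6) winding_length_bounds(1) by blast
  thus ?thesis using Z(1-3) by blast
qed

end

section \<open>Pair graphs\<close>

context pair_graph
begin

abbreviation edge :: "'a \<Rightarrow> 'a \<Rightarrow> bool" where
  "edge u w \<equiv> (u, w) \<in> parcs G"

lemma simple_adjacency_edge: "simple_adjacency edge"
proof
  show "edge u w \<Longrightarrow> edge w u" for u w
    using pair_sym_arcs by (auto simp: symmetric_def dest: symD)
  show "\<not> edge u u" for u using pair_no_loops by fastforce
qed

end

locale adjacency_pair_graph = pair_graph G + simple_adjacency edge
  for G :: "'a pair_pre_digraph"
begin

lemma nbs_subset_pverts: "nbs u \<subseteq> pverts G"
  using in_arcsD2 by (auto simp: nbs_def)

lemma adj_closed_pverts: "adj_closed (pverts G)"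
  unfolding adj_closed_def using nbs_subset_pverts by blast

lemma in_pverts_if_nbs_nonempty: "nbs u \<noteq> {} \<Longrightarrow> u \<in> pverts G"
  using in_arcsD1 by (auto simp: nbs_def)

lemma vdegree_eq_card_nbs: "vdegree G v = card (nbs v)"
proof -
  have "out_arcs (with_proj G) v = Pair v ` nbs v" by (auto simp: out_arcs_def)
  thus ?thesis by (simp add: out_degree_def card_image inj_on_def)
qed

lemma subcubic_adjacency_edge:
  assumes "subcubic G"
  shows "subcubic_adjacency edge"
proof
  fix u
  show "finite (nbs u)" using nbs_subset_pverts pair_finite_verts by (rule finite_subset)
  show "card (nbs u) \<le> 3"
  proof (cases "nbs u = {}")
    case False
    thus ?thesis
      using assms in_pverts_if_nbs_nonempty by (simp add: subcubic_def vdegree_eq_card_nbs)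
  qed simp
qed

lemma awalk_imp_dist_le: "awalk u p v \<Longrightarrow> dist_le (length p) u v"
proof (induction p arbitrary: u)
  case Nil thus ?case by (simp add: awalk_def)
next
  case (Cons e p)
  obtain x y where "e = (x, y)" by fastforce
  thus ?case using Cons by (auto simp: awalk_Cons_iff)
qed

lemma gdist_greater_if_not_dist_le:
  assumes "\<not> dist_le s u v"
  shows "gdist G u v > ereal (real s)"
proof (rule ccontr)
  assume "\<not> ?thesis"
  hence "gdist G u v \<le> ereal (real s)" by simp
  also have "\<dots> < ereal (real (Suc s))" by simp
  finally obtain p where p: "awalk u p v" "ereal (awalk_cost (\<lambda>_. 1) p) < ereal (real (Suc s))"
    unfolding gdist_def \<mu>_def INF_less_iff by blast
  have "awalk_cost (\<lambda>_. 1) p = real (length p)" by (simp add: awalk_cost_def sum_list_triv)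
  hence "length p \<le> s" using p(2) by simp
  thus False using assms dist_le_mono awalk_imp_dist_le[OF p(1)] by blast
qed

lemma packing_colorable_if_pack_colorable_on:
  assumes "pack_colorable_on S (pverts G)"
  shows "packing_colorable S G"
proof -
  obtain c where c: "packing_coloring S (pverts G) c"
    using assms unfolding pack_colorable_on_def by blast
  define V where "V i = {u \<in> pverts G. c u = i}" for i
  have "(\<Union>i < length S. V i) = pverts G" using c by (auto simp: V_def packing_coloring_def)
  moreover have "disjoint_family_on V {..<length S}" by (auto simp: disjoint_family_on_def V_def)
  moreover have "gdist G u v > ereal (real (S ! i))" if "u \<in> V i" "v \<in> V i" "u \<noteq> v" for i u v
  proof (rule gdist_greater_if_not_dist_le)
    have "u \<in> pverts G" "v \<in> pverts G" "c u = i" "c v = i" using that by (simp_all add: V_def)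
    thus "\<not> dist_le (S ! i) u v" using c that(3) unfolding packing_coloring_def by metis
  qed
  ultimately show ?thesis unfolding packing_colorable_def by blast
qed

lemma reachable_in_adj_closed:
  assumes "adj_closed Z" "u \<in> Z" "u \<rightarrow>\<^sup>*\<^bsub>with_proj G\<^esub> v"
  shows "v \<in> Z"
  using assms(3)
proof (induction rule: reachable_induct)
  case base thus ?case using assms(2) by simp
next
  case (step x y)
  hence "edge x y" by simp
  thus ?case using step assms(1) adj_closedD by blast
qed

lemma digraph_iso_induce_subgraph:
  assumes "inj_on h Z" "h ` Z = pverts H" "parcs H \<subseteq> pverts H \<times> pverts H"
    and edges: "\<And>u w. u \<in> Z \<Longrightarrow> w \<in> Z \<Longrightarrow> edge u w \<longleftrightarrow> (h u, h w) \<in> parcs H"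
  shows "digraph_iso (with_proj G \<restriction> Z) (with_proj H)"
proof -
  let ?GZ = "with_proj G \<restriction> Z"
  let ?hom = "\<lparr> iso_verts = h, iso_arcs = map_prod h h, iso_head = snd, iso_tail = fst \<rparr>"
  have "inj_on (map_prod h h) (Z \<times> Z)" using map_prod_inj_on[OF assms(1,1)] .
  hence "inj_on (map_prod h h) (arcs ?GZ)" by (rule inj_on_subset) auto
  hence "pre_digraph.digraph_isomorphism ?GZ ?hom"
    unfolding pre_digraph.digraph_isomorphism_def using assms(1) wellformed_induce_subgraph by auto
  moreover have "map_prod h h ` arcs ?GZ = parcs H"
  proof
    show "map_prod h h ` arcs ?GZ \<subseteq> parcs H" using edges by auto
    show "parcs H \<subseteq> map_prod h h ` arcs ?GZ"
    proof
      fix xy assume xy: "xy \<in> parcs H"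
      hence "xy \<in> h ` Z \<times> h ` Z" unfolding assms(2) by (rule subsetD[OF assms(3)])
      then obtain u w where "u \<in> Z" "w \<in> Z" "xy = (h u, h w)" by auto
      thus "xy \<in> map_prod h h ` arcs ?GZ"
        using xy edges by (auto intro!: image_eqI[of _ _ "(u, w)"])
    qed
  qed
  hence "with_proj H = app_iso ?hom ?GZ"
    using assms(2) unfolding app_iso_def by (simp add: with_proj_def)
  ultimately show ?thesis unfolding digraph_iso_def by blast
qed

lemma induce_subgraph_in_sccs:
  assumes Z: "adj_closed Z" "Z \<subseteq> pverts G" and a: "a \<in> Z"
    and reach: "\<And>v. v \<in> Z \<Longrightarrow> (a, v) \<in> (parcs G)\<^sup>*"
  shows "with_proj G \<restriction> Z \<in> sccs"
proof -
  have "a \<rightarrow>\<^sup>*\<^bsub>with_proj G\<^esub> v" if "(a, v) \<in> (parcs G)\<^sup>*" for v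
    using that
  proof (induction rule: rtrancl_induct)
    case base
    show ?case using a Z(2) by auto
  next
    case (step u w)
    thus ?case using reachable_adj_trans by simp
  qed
  hence "{v. a \<rightarrow>\<^sup>*\<^bsub>with_proj G\<^esub> v} = Z" using reachable_in_adj_closed[OF Z(1) a] reach by blast
  thus ?thesis using induce_reachable_is_in_sccs[of a] a Z(2) by auto
qed

lemma G1_on_in_sccs:
  assumes "G1_on Z" "adj_closed Z" "Z \<subseteq> pverts G"
  shows "with_proj G \<restriction> Z \<in> sccs"
proof -
  obtain a b c d e f where p: "five_cycle [a, b, c, d, e]" and f: "nbs f = {a, c}"
    and Z: "Z = {a, b, c, d, e, f}"
    using assms(1) unfolding G1_on_def by blast
  have "edge a b" "edge b c" "edge c d" "edge a e"
    using p adj_sym by (auto simp: five_cycle_iff)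
  moreover have "edge a f" using adj_iff_two[OF f] adj_sym by blast
  ultimately have "(a, v) \<in> (parcs G)\<^sup>*" if "v \<in> Z" for v
    using that unfolding Z by (auto intro: rtrancl_into_rtrancl)
  moreover have "a \<in> Z" by (simp add: Z)
  ultimately show ?thesis using induce_subgraph_in_sccs[OF assms(2,3)] by blast
qed

lemma G1_on_digraph_iso:
  assumes "G1_on Z"
  shows "digraph_iso (with_proj G \<restriction> Z) (with_proj graph_G1)"
proof -
  obtain a b c d e f where p: "five_cycle [a, b, c, d, e]"
    and f: "f \<notin> {a, b, c, d, e}" "nbs f = {a, c}" and Z: "Z = {a, b, c, d, e, f}"
    using assms unfolding G1_on_def by blast
  have dist: "distinct [a, b, c, d, e, f]" using p f(1) by (auto simp: five_cycle_iff)
  have f_iff: "edge f x \<longleftrightarrow> x = a \<or> x = c" "edge x f \<longleftrightarrow> x = a \<or> x = c" for x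
    using adj_iff_two[OF f(2)] adj_commute by metis+
  define h :: "'a \<Rightarrow> nat" where "h = (\<lambda>_. 6)(a := 3, b := 4, c := 5, d := 1, e := 2)"
  have h: "h a = 3" "h b = 4" "h c = 5" "h d = 1" "h e = 2" "h f = 6"
    using dist by (auto simp: h_def)
  have "\<forall>y\<in>Z. edge x y \<longleftrightarrow> (h x, h y) \<in> parcs graph_G1" if "x \<in> Z" for x
    using that p f(1) unfolding Z five_cycle_iff
    by (auto simp: graph_G1_def symcl_def h f_iff adj_irrefl adj_commute)
  moreover have "inj_on h Z" using h by (auto simp: Z inj_on_def)
  moreover have "h ` Z = pverts graph_G1" unfolding Z by (auto simp: h graph_G1_def)
  moreover have "parcs graph_G1 \<subseteq> pverts graph_G1 \<times> pverts graph_G1"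
    by (auto simp: graph_G1_def symcl_def)
  ultimately show ?thesis by (intro digraph_iso_induce_subgraph) blast+
qed

lemma has_G1_component_if_G1_on:
  assumes "G1_on Z" "adj_closed Z" "Z \<subseteq> pverts G"
  shows "has_G1_component G"
  unfolding has_G1_component_def
  using G1_on_in_sccs[OF assms] G1_on_digraph_iso[OF assms(1)] by blast

lemma cycle_length_3_triangle:
  assumes "cycle p" "length p = 3" "v \<in> fst ` set p"
  shows "\<exists>x y. edge v x \<and> edge v y \<and> edge x y"
proof -
  obtain u where "awalk u p u" using assms(1) unfolding cycle_def by blast
  hence p: "set p \<subseteq> parcs G" "pcas u p u" unfolding awalk_def by blast+
  obtain a1 a2 a3 where "p = [a1, a2, a3]"
    using assms(2) by (auto simp: length_Suc_conv numeral_eq_Suc)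
  then obtain x y where xy: "p = [(u, x), (x, y), (y, u)]"
    using p(2) by (cases a1; cases a2; cases a3) auto
  hence "edge u x" "edge x y" "edge y u" using p(1) by auto
  moreover have "v \<in> {u, x, y}" using assms(3) xy by auto
  ultimately show ?thesis using adj_sym by blast
qed

lemma cycle_length_4_square:
  assumes "cycle p" "length p = 4" "v \<in> fst ` set p"
  shows "\<exists>x y w. edge v x \<and> edge v y \<and> x \<noteq> y \<and> w \<noteq> v \<and> edge w x \<and> edge w y"
proof -
  obtain u where u: "awalk u p u" "distinct (tl (pawalk_verts u p))"
    using assms(1) unfolding cycle_def by blast
  hence p: "set p \<subseteq> parcs G" "pcas u p u" unfolding awalk_def by blast+
  obtain a1 a2 a3 a4 where "p = [a1, a2, a3, a4]"
    using assms(2) by (auto simp: length_Suc_conv numeral_eq_Suc)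
  then obtain x y z where xyz: "p = [(u, x), (x, y), (y, z), (z, u)]"
    using p(2) by (cases a1; cases a2; cases a3; cases a4) auto
  hence "edge u x" "edge x y" "edge y z" "edge z u" "distinct [u, x, y, z]" using p(1) u(2) by auto
  moreover have "v = u \<or> v = x \<or> v = y \<or> v = z" using assms(3) xyz by auto
  ultimately show ?thesis using adj_sym by (metis distinct_length_2_or_more)
qed

lemma short_cycle_if_g3_le:
  assumes "card (nbs v) = 3" "g3 G \<le> enat n"
  obtains p where "cycle p" "3 \<le> length p" "length p \<le> n" "v \<in> fst ` set p"
proof -
  have "nbs v \<noteq> {}" using assms(1) by auto
  hence "v \<in> pverts G" by (rule in_pverts_if_nbs_nonempty)
  hence "local_girth G v \<le> g3 G"
    unfolding g3_def using assms(1) by (intro SUP_upper) (simp add: vdegree_eq_card_nbs)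
  also have "\<dots> < enat (Suc n)" using assms(2) by (simp add: le_less_trans)
  finally obtain p where "cycle p" "3 \<le> length p" "v \<in> fst ` set p" "enat (length p) < enat (Suc n)"
    unfolding local_girth_def INF_less_iff by blast
  thus ?thesis using that by simp
qed

lemma card_cubic_nbs_if_saturated:
  assumes "saturated k G" "card (nbs v) = 3"
  shows "card {u \<in> nbs v. card (nbs u) = 3} \<le> k"
proof -
  have "nbs v \<noteq> {}" using assms(2) by auto
  hence "v \<in> pverts G" by (rule in_pverts_if_nbs_nonempty)
  moreover have "{u \<in> pverts G. edge v u \<and> vdegree G u = 3} = {u \<in> nbs v. card (nbs u) = 3}"
    using in_arcsD2 by (auto simp: vdegree_eq_card_nbs)
  ultimately show ?thesis using assms by (auto simp: saturated_def vdegree_eq_card_nbs)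
qed

end

locale subcubic_pair_graph = adjacency_pair_graph G + subcubic_adjacency edge
  for G :: "'a pair_pre_digraph"
begin

lemma packing_colorable_if_pieces:
  assumes "fold_transversal Q"
    and "\<And>Z. Z \<subseteq> pverts G \<Longrightarrow> adj_closed Z \<Longrightarrow> piece Z \<Longrightarrow> pack_colorable_on S Z"
  shows "packing_colorable S G"
proof (intro packing_colorable_if_pack_colorable_on
    pack_colorable_on_if_pieces[OF pair_finite_verts adj_closed_pverts])
  fix Y assume Y: "Y \<subseteq> pverts G" "adj_closed Y" "Y \<noteq> {}"
  have "finite Y" using Y(1) pair_finite_verts by (rule finite_subset)
  then obtain Z where Z: "Z \<subseteq> Y" "Z \<noteq> {}" "adj_closed Z" "piece Z"
    using ex_piece[OF assms(1) _ Y(2,3)] by blast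
  hence "pack_colorable_on S Z" using assms(2) Y(1) by blast
  thus "\<exists>Z\<subseteq>Y. Z \<noteq> {} \<and> adj_closed Z \<and> pack_colorable_on S Z" using Z by blast
qed

lemma fold_transversal_if_0_saturated:
  assumes "saturated 0 G" "g3 G \<le> 4"
  shows "fold_transversal twin_fold_set"
proof (rule fold_transversal_twin_fold_set)
  show cubic_independent unfolding cubic_independent_def
  proof (intro allI impI)
    fix v w assume "edge v w" "card (nbs v) = 3"
    moreover have "finite {u \<in> nbs v. card (nbs u) = 3}"
      by (rule finite_subset[OF _ finite_nbs]) blast
    ultimately have "{u \<in> nbs v. card (nbs u) = 3} = {}"
      using card_cubic_nbs_if_saturated[OF assms(1), of v] by (simp only: le_zero_eq card_0_eq)
    thus "card (nbs w) \<noteq> 3" using \<open>edge v w\<close> in_nbs by blast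
  qed
next
  fix v assume v: "card (nbs v) = 3"
  have "g3 G \<le> enat 4" using assms(2) by (simp add: numeral_eq_enat)
  then obtain p where p: "cycle p" "3 \<le> length p" "length p \<le> 4" "v \<in> fst ` set p"
    by (rule short_cycle_if_g3_le[OF v])
  then consider "length p = 3" | "length p = 4" by linarith
  thus "\<exists>x y. edge v x \<and> edge v y \<and> x \<noteq> y \<and> (edge x y \<or> (\<exists>w. w \<noteq> v \<and> edge w x \<and> edge w y))"
  proof cases
    case 1
    thus ?thesis using cycle_length_3_triangle[OF p(1) _ p(4)] adj_irrefl by metis
  next
    case 2
    thus ?thesis using cycle_length_4_square[OF p(1) _ p(4)] by blast
  qed
qed

lemma fold_transversal_if_1_saturated:
  assumes "saturated 1 G" "g3 G = 3"
  shows "fold_transversal triangle_fold_set"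
proof (rule fold_transversal_triangle_fold_set)
  show cubic_matching unfolding cubic_matching_def
  proof (intro allI impI)
    fix v x y
    assume "card (nbs v) = 3" "edge v x" "edge v y" "card (nbs x) = 3" "card (nbs y) = 3"
    moreover have "finite {u \<in> nbs v. card (nbs u) = 3}"
      by (rule finite_subset[OF _ finite_nbs]) blast
    ultimately show "x = y"
      using card_cubic_nbs_if_saturated[OF assms(1), of v]
        card_le_Suc0_iff_eq[of "{u \<in> nbs v. card (nbs u) = 3}"] by auto
  qed
next
  fix v assume v: "card (nbs v) = 3"
  have "g3 G \<le> enat 3" using assms(2) by (simp add: numeral_eq_enat)
  then obtain p where p: "cycle p" "3 \<le> length p" "length p \<le> 3" "v \<in> fst ` set p"
    by (rule short_cycle_if_g3_le[OF v])
  thus "\<exists>x y. edge v x \<and> edge v y \<and> edge x y" using cycle_length_3_triangle by simp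
qed

end

lemma subcubic_pair_graphI:
  assumes "pair_graph G" "subcubic G"
  shows "subcubic_pair_graph G"
proof -
  interpret pair_graph G by fact
  interpret simple_adjacency edge by (rule simple_adjacency_edge)
  interpret adjacency_pair_graph G by unfold_locales
  interpret subcubic_adjacency edge using assms(2) by (rule subcubic_adjacency_edge)
  show ?thesis by unfold_locales
qed

theorem theorem1:
  fixes G :: "'a pair_pre_digraph"
  assumes "pair_graph G"
    and "subcubic G"
    and "(saturated 0 G \<and> g3 G \<le> 4) \<or> (saturated 1 G \<and> g3 G = 3)"
  shows "(\<forall>k::nat. k \<ge> 3 \<longrightarrow> packing_colorable [1, 1, 3, k] G) \<and>
         packing_colorable [1, 2, 2, 3] G \<and>
         (\<not> has_G1_component G \<longrightarrow> packing_colorable [2, 2, 2, 2, 3] G) \<and>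
         (\<forall>k::nat. k \<ge> 6 \<longrightarrow> packing_colorable [1, 2, 3, 4, 5, k] G)"
proof -
  interpret subcubic_pair_graph G using assms(1,2) by (rule subcubic_pair_graphI)
  obtain Q where "fold_transversal Q"
    using assms(3) fold_transversal_if_0_saturated fold_transversal_if_1_saturated by blast
  note colorable = packing_colorable_if_pieces[OF this]
  have "packing_colorable [1, 1, 3, k] G" for k
    using colorable pack_colorable_on_piece(1) by blast
  moreover have "packing_colorable [1, 2, 2, 3] G"
    using colorable pack_colorable_on_piece(2) by blast
  moreover have "packing_colorable [2, 2, 2, 2, 3] G" if "\<not> has_G1_component G"
    using that colorable pack_colorable_on_piece(3) has_G1_component_if_G1_on by blast
  moreover have "packing_colorable [1, 2, 3, 4, 5, k] G" for k
    using colorable pack_colorable_on_piece(4) by blast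
  ultimately show ?thesis by blast
qed

end
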